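(* Let $\lambda>0$ and $0\le\mu<1$, and assume: (1) there is $C_m>0$ such that for every $\theta\in\mathbb{R}^{N_p}$, $\mathbb{E}_{X\sim\pi_\theta}\big[\|\nabla_\theta\log|\psi_\theta(X)|\|^4\big]\le C_m$ and $\mathbb{E}_{X\sim\pi_\theta}\big[E_{\mathrm{loc}}(\theta;X)^4\big]\le C_m$; (2) there is $C_g>0$ such that $\|g(\theta)-g(\theta')\|\le C_g\|\theta-\theta'\|$ for all $\theta,\theta'\in\mathbb{R}^{N_p}$; (3) the step sizes satisfy $0<\eta_k\le\eta_{k-1}$ for all $k\ge1$, and $0<\eta_0\le \frac{2\lambda(1-\mu)}{C_g}$. Fix deterministic initial vectors $\theta_0,\Delta\theta_{-1}\in\mathbb{R}^{N_p}$. For a sample size $N_s\ge2$, let $\{\theta_k\}_{k\ge0}$ be generated by the SPRING iteration $$\Delta\theta_k=(\lambda I+S(\theta_k;\mathcal{B}_k))^{-1}\Big(\lambda\mu\,\Delta\theta_{k-1}-\tfrac12 g(\theta_k;\mathcal{B}_k)\Big),\qquad \theta_{k+1}=\theta_k+\eta_k\Delta\theta_k,\qquad k\ge 0,$$ where for each $k\ge0$ the batch $\mathcal{B}_k=\{X_{k,1},\dots,X_{k,N_s}\}$ consists, conditionally on all earlier batches, of i.i.d. samples from $\pi_{\theta_k}$. Then there exist $C_1,C_2,C_3>0$, independent of $K$ and $N_s$, such that for every $K\ge1$, $$\sum_{k=1}^K\eta_k\,\mathbb{E}\big[\|g(\theta_k)\|^2\big]\le C_1+C_2\frac{1}{N_s}\sum_{k=1}^K\eta_k+C_3\frac{1}{N_s^2}\sum_{k=1}^K\eta_k,$$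 where $\mathbb{E}[\cdot]$ is the total expectation.
   Context: Variational Monte Carlo setting. $N$ is the number of particles, $\Omega$ the single-particle configuration space (continuous, or discrete, in which case integrals over $\Omega^N$ denote sums), and $\mathscr{H}$ is a self-adjoint Hamiltonian acting on functions on $\Omega^N$. $\{\psi_\theta\}_{\theta\in\mathbb{R}^{N_p}}$ is a parametrized family of nonzero square-integrable real-valued wavefunctions $\psi_\theta:\Omega^N\to\mathbb{R}$. Define: - $\pi_\theta(x)=|\psi_\theta(x)|^2/\int|\psi_\theta|^2$, a probability density (or mass function) on $\Omega^N$; - local energy $E_{\mathrm{loc}}(\theta;x)=(\mathscr{H}\psi_\theta)(x)/\psi_\theta(x)$; - energy $L(\theta)=\langle\psi_\theta|\mathscr{H}|\psi_\theta\rangle/\langle\psi_\theta|\psi_\theta\rangle=\mathbb{E}_{X\sim\pi_\theta}[E_{\mathrm{loc}}(\theta;X)]$; - $\bar E(\theta;x)=E_{\mathrm{loc}}(\theta;x)-L(\theta)$ and $O(\theta;x)=\nabla_\theta\log|\psi_\theta(x)|-\mathbb{E}_{X\sim\pi_\theta}[\nabla_\theta\log|\psi_\theta(X)|]\in\mathbb{R}^{N_p}$; - gradient $g(\theta)=\nabla_\theta L(\theta)$, for which the standard VMC identity $g(\theta)=2\,\mathbb{E}_{X\sim\pi_\theta}[\bar E(\theta;X)O(\theta;X)]$ holds (standing assumption of the setting). Monte Carlo estimators for a batch $\mathcal{B}=\{X_1,\dots,X_{N_s}\}$, $N_s\ge2$: $L(\theta;\mathcal{B})=\frac1{N_s}\sum_i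 E_{\mathrm{loc}}(\theta;X_i)$, $\bar E(\theta;X_i,\mathcal{B})=E_{\mathrm{loc}}(\theta;X_i)-L(\theta;\mathcal{B})$, $O(\theta;X_i,\mathcal{B})=\nabla_\theta\log|\psi_\theta(X_i)|-\frac1{N_s}\sum_j\nabla_\theta\log|\psi_\theta(X_j)|$, $$g(\theta;\mathcal{B})=\frac{2}{N_s-1}\sum_{i=1}^{N_s}\bar E(\theta;X_i,\mathcal{B})\,O(\theta;X_i,\mathcal{B}),\qquad S(\theta;\mathcal{B})=\frac{1}{N_s-1}\sum_{i=1}^{N_s}O(\theta;X_i,\mathcal{B})\,O(\theta;X_i,\mathcal{B})^\top.$$ $\|\cdot\|$ is the Euclidean norm. In the algorithm of interest $\Delta\theta_{-1}=0$. *)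

theory Defs
  imports "HOL-Probability.Probability"
begin

section \<open>Gradients and self-adjoint operators\<close>

definition grad :: "('a::real_inner \<Rightarrow> real) \<Rightarrow> 'a \<Rightarrow> 'a" where
  "grad f x = (THE D. GDERIV f x :> D)"

definition L2 :: "'c measure \<Rightarrow> ('c \<Rightarrow> real) set" where
  "L2 M = {f \<in> borel_measurable M. integrable M (\<lambda>x. (f x)\<^sup>2)}"

definition L2_inner :: "'c measure \<Rightarrow> ('c \<Rightarrow> real) \<Rightarrow> ('c \<Rightarrow> real) \<Rightarrow> real" where
  "L2_inner M f g = (\<integral>x. f x * g x \<partial>M)"

text \<open>
  A densely defined, possibly unbounded operator \<open>H\<close> with domain \<open>D\<close>, acting on representatives
  of \<open>L\<^sup>2\<close> classes; equations between its values are therefore almost-everywhere equations. The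
  last conjunct says that the graph of the adjoint of \<open>H\<close> is the graph of \<open>H\<close> (so that the domains
  agree as well); it also makes \<open>D\<close> and \<open>H\<close> compatible with almost-everywhere equality.
\<close>

definition self_adjoint_operator ::
  "'c measure \<Rightarrow> ('c \<Rightarrow> real) set \<Rightarrow> (('c \<Rightarrow> real) \<Rightarrow> 'c \<Rightarrow> real) \<Rightarrow> bool" where
  "self_adjoint_operator M D H \<longleftrightarrow>
     D \<subseteq> L2 M \<and> H ` D \<subseteq> L2 M \<and>
     (\<forall>f\<in>D. \<forall>g\<in>D. \<forall>a b. (\<lambda>x. a * f x + b * g x) \<in> D \<and>
        (AE x in M. H (\<lambda>x. a * f x + b * g x) x = a * H f x + b * H g x)) \<and>
     (\<forall>f\<in>L2 M. \<forall>e>0. \<exists>g\<in>D. (\<integral>x. (f x - g x)\<^sup>2 \<partial>M) < e) \<and>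
     (\<forall>g\<in>L2 M. \<forall>h\<in>L2 M.
        (\<forall>f\<in>D. L2_inner M (H f) g = L2_inner M f h) \<longleftrightarrow> g \<in> D \<and> (AE x in M. H g x = h x))"


section \<open>Variational Monte Carlo\<close>

text \<open>
  The single-particle space is a measure space \<open>\<Omega>\<close>: for instance Lebesgue measure on a Euclidean
  space, or counting measure on a countable set, in which case the integrals below are sums.
  A family of wavefunctions is a function \<open>\<psi>\<close> of the parameter and the configuration.
\<close>

abbreviation config_space :: "'w measure \<Rightarrow> nat \<Rightarrow> (nat \<Rightarrow> 'w) measure" where
  "config_space \<Omega> N \<equiv> PiM {..<N} (\<lambda>_. \<Omega>)"

definition born :: "'c measure \<Rightarrow> (real ^ 'p \<Rightarrow> 'c \<Rightarrow> real) \<Rightarrow> real ^ 'p \<Rightarrow> 'c measure" where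
  "born M \<psi> \<theta> = density M (\<lambda>x. ennreal (\<bar>\<psi> \<theta> x\<bar>\<^sup>2 / (\<integral>y. \<bar>\<psi> \<theta> y\<bar>\<^sup>2 \<partial>M)))"

text \<open>
  Local energy and score are only meaningful off the nodal set of \<open>\<psi> \<theta>\<close>, which is a null set of
  \<open>born M \<psi> \<theta>\<close>; on it both are \<open>0\<close> (for the local energy because \<open>a / 0 = 0\<close>).
\<close>

definition local_energy ::
  "(('c \<Rightarrow> real) \<Rightarrow> 'c \<Rightarrow> real) \<Rightarrow> (real ^ 'p \<Rightarrow> 'c \<Rightarrow> real) \<Rightarrow> real ^ 'p \<Rightarrow> 'c \<Rightarrow> real" where
  "local_energy H \<psi> \<theta> x = H (\<psi> \<theta>) x / \<psi> \<theta> x"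

definition score :: "(real ^ 'p \<Rightarrow> 'c \<Rightarrow> real) \<Rightarrow> real ^ 'p \<Rightarrow> 'c \<Rightarrow> real ^ 'p" where
  "score \<psi> \<theta> x = (if \<psi> \<theta> x = 0 then 0 else grad (\<lambda>t. ln \<bar>\<psi> t x\<bar>) \<theta>)"

definition energy ::
  "'c measure \<Rightarrow> (('c \<Rightarrow> real) \<Rightarrow> 'c \<Rightarrow> real) \<Rightarrow> (real ^ 'p \<Rightarrow> 'c \<Rightarrow> real) \<Rightarrow> real ^ 'p \<Rightarrow> real" where
  "energy M H \<psi> \<theta> = L2_inner M (\<psi> \<theta>) (H (\<psi> \<theta>)) / L2_inner M (\<psi> \<theta>) (\<psi> \<theta>)"

definition energy_grad ::
  "'c measure \<Rightarrow> (('c \<Rightarrow> real) \<Rightarrow> 'c \<Rightarrow> real) \<Rightarrow> (real ^ 'p \<Rightarrow> 'c \<Rightarrow> real) \<Rightarrow> real ^ 'p \<Rightarrow> real ^ 'p" where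
  "energy_grad M H \<psi> = grad (energy M H \<psi>)"

definition centered_energy ::
  "'c measure \<Rightarrow> (('c \<Rightarrow> real) \<Rightarrow> 'c \<Rightarrow> real) \<Rightarrow> (real ^ 'p \<Rightarrow> 'c \<Rightarrow> real) \<Rightarrow> real ^ 'p \<Rightarrow> 'c \<Rightarrow> real" where
  "centered_energy M H \<psi> \<theta> x = local_energy H \<psi> \<theta> x - energy M H \<psi> \<theta>"

definition centered_score ::
  "'c measure \<Rightarrow> (real ^ 'p \<Rightarrow> 'c \<Rightarrow> real) \<Rightarrow> real ^ 'p \<Rightarrow> 'c \<Rightarrow> real ^ 'p" where
  "centered_score M \<psi> \<theta> x = score \<psi> \<theta> x - (\<integral>y. score \<psi> \<theta> y \<partial>born M \<psi> \<theta>)"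


section \<open>Monte Carlo estimators\<close>

text \<open>A batch of size \<open>n\<close> is the indexed family \<open>b 0, \<dots>, b (n - 1)\<close>.\<close>

definition batch_energy ::
  "(('c \<Rightarrow> real) \<Rightarrow> 'c \<Rightarrow> real) \<Rightarrow> (real ^ 'p \<Rightarrow> 'c \<Rightarrow> real) \<Rightarrow> nat \<Rightarrow> real ^ 'p \<Rightarrow> (nat \<Rightarrow> 'c) \<Rightarrow> real" where
  "batch_energy H \<psi> n \<theta> b = (1 / real n) * (\<Sum>i<n. local_energy H \<psi> \<theta> (b i))"

definition batch_centered_energy ::
  "(('c \<Rightarrow> real) \<Rightarrow> 'c \<Rightarrow> real) \<Rightarrow> (real ^ 'p \<Rightarrow> 'c \<Rightarrow> real) \<Rightarrow> nat \<Rightarrow> real ^ 'p \<Rightarrow> (nat \<Rightarrow> 'c) \<Rightarrow> nat \<Rightarrow> real" where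
  "batch_centered_energy H \<psi> n \<theta> b i = local_energy H \<psi> \<theta> (b i) - batch_energy H \<psi> n \<theta> b"

definition batch_centered_score ::
  "(real ^ 'p \<Rightarrow> 'c \<Rightarrow> real) \<Rightarrow> nat \<Rightarrow> real ^ 'p \<Rightarrow> (nat \<Rightarrow> 'c) \<Rightarrow> nat \<Rightarrow> real ^ 'p" where
  "batch_centered_score \<psi> n \<theta> b i =
     score \<psi> \<theta> (b i) - (1 / real n) *\<^sub>R (\<Sum>j<n. score \<psi> \<theta> (b j))"

definition batch_grad ::
  "(('c \<Rightarrow> real) \<Rightarrow> 'c \<Rightarrow> real) \<Rightarrow> (real ^ 'p \<Rightarrow> 'c \<Rightarrow> real) \<Rightarrow> nat \<Rightarrow> real ^ 'p \<Rightarrow> (nat \<Rightarrow> 'c) \<Rightarrow> real ^ 'p" where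
  "batch_grad H \<psi> n \<theta> b =
     (2 / (real n - 1)) *\<^sub>R
       (\<Sum>i<n. batch_centered_energy H \<psi> n \<theta> b i *\<^sub>R batch_centered_score \<psi> n \<theta> b i)"

definition outer :: "real ^ 'm \<Rightarrow> real ^ 'n \<Rightarrow> real ^ 'n ^ 'm" where
  "outer u v = (\<chi> i j. u $ i * v $ j)"

definition batch_S ::
  "(real ^ 'p \<Rightarrow> 'c \<Rightarrow> real) \<Rightarrow> nat \<Rightarrow> real ^ 'p \<Rightarrow> (nat \<Rightarrow> 'c) \<Rightarrow> real ^ 'p ^ 'p" where
  "batch_S \<psi> n \<theta> b =
     (1 / (real n - 1)) *\<^sub>R
       (\<Sum>i<n. outer (batch_centered_score \<psi> n \<theta> b i) (batch_centered_score \<psi> n \<theta> b i))"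


section \<open>The SPRING iteration\<close>

text \<open>
  The increments are stored with their index shifted by one: \<open>\<Delta> (Suc k)\<close> is the increment
  \<open>\<Delta>\<theta>\<^sub>k\<close> computed in step \<open>k\<close>, and \<open>\<Delta> 0\<close> is the initial increment with index \<open>-1\<close>.
\<close>

definition spring_iterates ::
  "(('c \<Rightarrow> real) \<Rightarrow> 'c \<Rightarrow> real) \<Rightarrow> (real ^ 'p \<Rightarrow> 'c \<Rightarrow> real) \<Rightarrow> real \<Rightarrow> real \<Rightarrow> (nat \<Rightarrow> real) \<Rightarrow>
   real ^ 'p \<Rightarrow> real ^ 'p \<Rightarrow> nat \<Rightarrow> (nat \<Rightarrow> nat \<Rightarrow> 'c) \<Rightarrow>
   (nat \<Rightarrow> real ^ 'p) \<Rightarrow> (nat \<Rightarrow> real ^ 'p) \<Rightarrow> bool" where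
  "spring_iterates H \<psi> lam mu eta \<theta>init \<Delta>init n b \<theta> \<Delta> \<longleftrightarrow>
     \<theta> 0 = \<theta>init \<and> \<Delta> 0 = \<Delta>init \<and>
     (\<forall>k. \<Delta> (Suc k) =
            matrix_inv (lam *\<^sub>R mat 1 + batch_S \<psi> n (\<theta> k) (b k)) *v
              ((lam * mu) *\<^sub>R \<Delta> k - (1 / 2) *\<^sub>R batch_grad H \<psi> n (\<theta> k) (b k)) \<and>
          \<theta> (Suc k) = \<theta> k + eta k *\<^sub>R \<Delta> (Suc k))"

definition past_batches :: "'o measure \<Rightarrow> 'c measure \<Rightarrow> nat \<Rightarrow> (nat \<Rightarrow> nat \<Rightarrow> 'o \<Rightarrow> 'c) \<Rightarrow> nat \<Rightarrow> 'o measure" where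
  "past_batches P M n X k =
     sigma (space P) {X j i -` A \<inter> space P | j i A. j < k \<and> i < n \<and> A \<in> sets M}"

text \<open>
  Given the sigma-algebra of the batches \<open>0, \<dots>, k - 1\<close>, the samples \<open>X k 0, \<dots>, X k (n - 1)\<close> are
  independent and each has law \<open>born M \<psi> (\<theta> k)\<close>.
\<close>

definition adaptive_batches ::
  "'o measure \<Rightarrow> 'c measure \<Rightarrow> (real ^ 'p \<Rightarrow> 'c \<Rightarrow> real) \<Rightarrow> nat \<Rightarrow>
   (nat \<Rightarrow> nat \<Rightarrow> 'o \<Rightarrow> 'c) \<Rightarrow> (nat \<Rightarrow> 'o \<Rightarrow> real ^ 'p) \<Rightarrow> bool" where
  "adaptive_batches P M \<psi> n X \<theta> \<longleftrightarrow>
     (\<forall>k. \<forall>i<n. X k i \<in> measurable P M) \<and>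
     (\<forall>k A. (\<forall>i<n. A i \<in> sets M) \<longrightarrow>
        (AE \<omega> in P. real_cond_exp P (past_batches P M n X k)
             (indicator {\<omega> \<in> space P. \<forall>i<n. X k i \<omega> \<in> A i}) \<omega>
           = (\<Prod>i<n. measure (born M \<psi> (\<theta> k \<omega>)) (A i))))"

end

theory Submission
  imports Defs
begin

text \<open>
  Multiplying the update by the regularized matrix gives the implicit equation
  \<open>S\<^sub>k \<Delta>\<theta>\<^sub>k + \<lambda> (\<Delta>\<theta>\<^sub>k - \<mu> \<Delta>\<theta>\<^sub>k\<^sub>-\<^sub>1) = - g(\<theta>\<^sub>k; B\<^sub>k) / 2\<close>. Paired with \<open>\<Delta>\<theta>\<^sub>k\<close> it turns
  \<open>L(\<theta>\<^sub>k) + \<lambda> \<mu> \<eta>\<^sub>k \<parallel>\<Delta>\<theta>\<^sub>k\<^sub>-\<^sub>1\<parallel>\<^sup>2\<close> into a Lyapunov function along every path, up to the gradient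
  error \<open>\<parallel>g(\<theta>\<^sub>k; B\<^sub>k) - g(\<theta>\<^sub>k)\<parallel>\<^sup>2\<close>; this bounds the weighted sums of both \<open>\<parallel>\<Delta>\<theta>\<^sub>k\<parallel>\<^sup>2\<close> and
  \<open>\<Delta>\<theta>\<^sub>k \<bullet> S\<^sub>k \<Delta>\<theta>\<^sub>k\<close>. Paired with \<open>g(\<theta>\<^sub>k)\<close> it bounds \<open>\<parallel>g(\<theta>\<^sub>k)\<parallel>\<^sup>2\<close> by these quantities, the
  gradient error and a small multiple of \<open>g(\<theta>\<^sub>k) \<bullet> S\<^sub>k g(\<theta>\<^sub>k)\<close>. Randomness enters only through two
  conditional expectations: the squared gradient error is of order \<open>1 / N\<^sub>s\<close>, being the error of a
  sample covariance, and \<open>g(\<theta>\<^sub>k) \<bullet> S\<^sub>k g(\<theta>\<^sub>k)\<close> is at most a constant times \<open>\<parallel>g(\<theta>\<^sub>k)\<parallel>\<^sup>2\<close>. The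
  correlation between \<open>S\<^sub>k\<close> and \<open>g(\<theta>\<^sub>k; B\<^sub>k)\<close> plays no role.
\<close>

section \<open>Gradients\<close>

text \<open>In finite dimension a derivative is the inner product with the vector \<open>D\<close>
  of its values on \<open>Basis\<close>; uniqueness of derivatives makes the definite description in
  \<open>grad\<close> pick this \<open>D\<close>.\<close>

lemma GDERIV_grad:
  fixes f :: "'a::euclidean_space \<Rightarrow> real"
  assumes "f differentiable (at x)"
  shows "GDERIV f x :> grad f x"
proof -
  obtain f' where f': "(f has_derivative f') (at x)"
    using assms by (auto simp: differentiable_def)
  then interpret linear f' by (rule has_derivative_linear)
  define D where "D = (\<Sum>b\<in>Basis. f' b *\<^sub>R b)"
  have "f' = (\<lambda>h. inner h D)"
  proof
    fix h
    have "f' h = f' (\<Sum>b\<in>Basis. inner h b *\<^sub>R b)" by (simp add: euclidean_representation)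
    also have "\<dots> = inner h D" by (simp add: D_def sum scale inner_sum_right algebra_simps)
    finally show "f' h = inner h D" .
  qed
  with f' have D: "GDERIV f x :> D" by (simp add: gderiv_def)
  have "grad f x = D" unfolding grad_def
  proof (rule the_equality)
    show "GDERIV f x :> D" by (rule D)
  next
    fix D' assume "GDERIV f x :> D'"
    then have "(\<lambda>h. inner h D') = (\<lambda>h. inner h D)"
      using D unfolding gderiv_def by (rule has_derivative_unique)
    then have "\<forall>h. inner h D' = inner h D" by meson
    then show "D' = D" using vector_eq_ldot[of D' D] by blast
  qed
  with D show ?thesis by simp
qed

text \<open>The descent lemma: the slope along the segment drifts from \<open>inner (G x) h\<close>
  by at most \<open>C * t\<close> times the squared length of \<open>h\<close>.\<close>

lemma Lipschitz_gradient_descent: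
  fixes f :: "'a::real_inner \<Rightarrow> real"
  assumes deriv: "\<And>x. GDERIV f x :> G x"
    and lipschitz: "\<And>x y. norm (G x - G y) \<le> C * norm (x - y)"
  shows "f (x + h) \<le> f x + inner (G x) h + C / 2 * (norm h)\<^sup>2"
proof -
  \<comment> \<open>The derivative of the subtracted quadratic term is exactly the Lipschitz bound
    for the drift of the slope, so \<open>\<phi>\<close> is nonincreasing on [0, 1].\<close>
  define \<phi> where "\<phi> t = f (x + t *\<^sub>R h) - t * inner (G x) h - C / 2 * (norm h)\<^sup>2 * t\<^sup>2" for t :: real
  have "\<phi> 1 \<le> \<phi> 0"
  proof (rule DERIV_nonpos_imp_nonincreasing[where f = \<phi>])
    fix t :: real assume t: "0 \<le> t" "t \<le> 1"
    have "((\<lambda>t. f (x + t *\<^sub>R h)) has_derivative (\<lambda>s. inner (s *\<^sub>R h) (G (x + t *\<^sub>R h)))) (at t)"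
      using deriv[of "x + t *\<^sub>R h"] unfolding gderiv_def
      by (intro has_derivative_compose[where f="\<lambda>t. x + t *\<^sub>R h" and f'="\<lambda>s. s *\<^sub>R h" and g=f])
        (auto intro!: derivative_eq_intros)
    then have "((\<lambda>t. f (x + t *\<^sub>R h)) has_real_derivative inner h (G (x + t *\<^sub>R h))) (at t)"
      by (rule has_derivative_imp_has_field_derivative) simp
    then have d: "(\<phi> has_real_derivative
        inner h (G (x + t *\<^sub>R h)) - inner (G x) h - C * (norm h)\<^sup>2 * t) (at t)"
      unfolding \<phi>_def by (auto intro!: derivative_eq_intros)
    have "inner h (G (x + t *\<^sub>R h)) - inner (G x) h = inner h (G (x + t *\<^sub>R h) - G x)"
      by (simp add: inner_diff_right inner_commute)
    also have "\<dots> \<le> norm h * norm (G (x + t *\<^sub>R h) - G x)" by (rule norm_cauchy_schwarz)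
    also have "\<dots> \<le> norm h * (C * norm (t *\<^sub>R h))"
      using lipschitz[of "x + t *\<^sub>R h" x] by (intro mult_left_mono) auto
    also have "\<dots> = C * (norm h)\<^sup>2 * t" using t by (simp add: power2_eq_square)
    finally show "\<exists>y. (\<phi> has_real_derivative y) (at t) \<and> y \<le> 0" using d by force
  qed simp
  then show ?thesis by (simp add: \<phi>_def)
qed


section \<open>The pathwise Lyapunov argument\<close>

text \<open>Young's inequality by completing the square. The free weight \<open>s\<close> decides
  which of the two squares is small enough to be absorbed.\<close>

lemma mult_le_weighted_squares:
  fixes a b s :: real
  assumes "s > 0"
  shows "a * b \<le> s * a\<^sup>2 + b\<^sup>2 / (4 * s)"
proof -
  have "0 \<le> (2 * s * a - b)\<^sup>2 / (4 * s)" using assms by simp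
  also have "\<dots> = s * a\<^sup>2 + b\<^sup>2 / (4 * s) - a * b"
    using assms by (simp add: power2_eq_square field_simps)
  finally show ?thesis by simp
qed

text \<open>One sample path as a deterministic recursion: \<open>u k\<close> stands for the matrix
  \<open>S\<close> of step \<open>k\<close> applied to the new increment, \<open>v k\<close> for the
  batch gradient, \<open>r k\<close> for \<open>g \<bullet> S g\<close>. Positive semidefiniteness
  of \<open>S\<close> is kept only as \<open>u_nonneg\<close> and the weighted Cauchy-Schwarz
  inequality \<open>u_bound\<close>.\<close>

locale momentum_path =
  fixes L :: "'a::real_inner \<Rightarrow> real" and G :: "'a \<Rightarrow> 'a"
    and lam mu C B :: real and eta :: "nat \<Rightarrow> real"
    and \<theta> \<Delta> u v :: "nat \<Rightarrow> 'a" and r :: "nat \<Rightarrow> real"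
  assumes deriv: "\<And>x. GDERIV L x :> G x"
    and lipschitz: "\<And>x y. norm (G x - G y) \<le> C * norm (x - y)"
    and bounded: "\<And>x. \<bar>L x\<bar> \<le> B"
    and lam: "lam > 0" and mu: "0 \<le> mu" "mu < 1" and C: "C > 0"
    and eta_pos: "\<And>k. 0 < eta k" and eta_Suc: "\<And>k. eta (Suc k) \<le> eta k"
    and eta_0: "eta 0 \<le> 2 * lam * (1 - mu) / C"
    and \<theta>_Suc: "\<And>k. \<theta> (Suc k) = \<theta> k + eta k *\<^sub>R \<Delta> (Suc k)"
    and implicit: "\<And>k. lam *\<^sub>R \<Delta> (Suc k) + u k = (lam * mu) *\<^sub>R \<Delta> k - (1 / 2) *\<^sub>R v k"
    and u_nonneg: "\<And>k. 0 \<le> inner (u k) (\<Delta> (Suc k))"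
    and u_bound: "\<And>k t. t > 0 \<Longrightarrow>
      - 2 * inner (G (\<theta> k)) (u k) \<le> t * r k + inner (u k) (\<Delta> (Suc k)) / t"
begin

abbreviation "kappa \<equiv> lam * (1 - mu)"

lemma kappa_pos: "kappa > 0" using lam mu by simp

text \<open>The step size restriction in the form that absorbs the curvature term of the descent
  lemma; decreasing steps reduce it to \<open>eta 0\<close>.\<close>

lemma eta_le: "C * eta k / 2 \<le> kappa"
proof -
  have "eta k \<le> eta 0" by (induction k) (auto intro: order_trans[OF eta_Suc])
  then have "eta k \<le> 2 * lam * (1 - mu) / C" using eta_0 by simp
  then show ?thesis using C by (simp add: field_simps)
qed

text \<open>What remains of the Lyapunov decrease per unit of step size: of \<open>2 * kappa\<close>
  squared increments, the curvature uses \<open>kappa\<close> and the gradient error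
  \<open>kappa / 2\<close>.\<close>

definition dissipation :: "nat \<Rightarrow> real" where
  "dissipation k = kappa / 2 * (norm (\<Delta> (Suc k)))\<^sup>2 + 2 * inner (u k) (\<Delta> (Suc k))"

lemma increment_le_dissipation: "(norm (\<Delta> (Suc k)))\<^sup>2 \<le> 2 / kappa * dissipation k"
  unfolding dissipation_def using u_nonneg[of k] kappa_pos by (simp add: field_simps)

text \<open>
  Pairing the implicit equation for the increment with the increment itself shows that
  \<open>L (\<theta> k) + lam * mu * eta k * (norm (\<Delta> k))\<^sup>2\<close> decreases up to the gradient error.
\<close>

lemma lyapunov_step:
  "L (\<theta> (Suc k)) + lam * mu * eta (Suc k) * (norm (\<Delta> (Suc k)))\<^sup>2 + eta k * dissipation k
    \<le> L (\<theta> k) + lam * mu * eta k * (norm (\<Delta> k))\<^sup>2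
      + eta k * (norm (v k - G (\<theta> k)))\<^sup>2 / (2 * kappa)"
proof -
  define d where "d = \<Delta> (Suc k)"
  define q where "q = \<Delta> k"
  define p where "p = inner (u k) d"
  define e where "e = v k - G (\<theta> k)"
  have v: "v k = (2 * lam * mu) *\<^sub>R q - 2 *\<^sub>R u k - (2 * lam) *\<^sub>R d"
  proof -
    have "(1 / 2) *\<^sub>R v k = (lam * mu) *\<^sub>R q - (lam *\<^sub>R d + u k)"
      using implicit[of k] by (simp add: d_def q_def)
    then have "2 *\<^sub>R ((1 / 2) *\<^sub>R v k) = 2 *\<^sub>R ((lam * mu) *\<^sub>R q - (lam *\<^sub>R d + u k))" by simp
    then show ?thesis by (simp add: algebra_simps)
  qed
  have vd: "inner (v k) d = 2 * lam * mu * inner q d - 2 * p - 2 * lam * (norm d)\<^sup>2"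
    by (simp add: v inner_diff_left p_def power2_norm_eq_inner)
  \<comment> \<open>The momentum cross term is split evenly between the old increment, already
    stored in the Lyapunov function, and the new one.\<close>
  have qd: "2 * inner q d \<le> (norm q)\<^sup>2 + (norm d)\<^sup>2"
  proof -
    have "0 \<le> (norm (q - d))\<^sup>2" by simp
    then show ?thesis by (simp add: power2_norm_eq_inner inner_diff inner_commute)
  qed
  have vd': "inner (v k) d \<le> lam * mu * (norm q)\<^sup>2 + lam * mu * (norm d)\<^sup>2 - 2 * p - 2 * lam * (norm d)\<^sup>2"
    using mult_left_mono[OF qd, of "lam * mu"] lam mu vd by (simp add: algebra_simps)
  have ed: "- inner e d \<le> kappa / 2 * (norm d)\<^sup>2 + (norm e)\<^sup>2 / (2 * kappa)"
  proof -
    have "- inner e d \<le> norm d * norm e"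
      using norm_cauchy_schwarz[of "-e" d] by (simp add: mult.commute)
    also have "\<dots> \<le> kappa / 2 * (norm d)\<^sup>2 + (norm e)\<^sup>2 / (4 * (kappa / 2))"
      using kappa_pos by (intro mult_le_weighted_squares) simp
    finally show ?thesis by simp
  qed
  have Gd: "inner (G (\<theta> k)) d = inner (v k) d - inner e d" by (simp add: e_def inner_diff_left)
  have "L (\<theta> (Suc k)) \<le> L (\<theta> k) + inner (G (\<theta> k)) (eta k *\<^sub>R d) + C / 2 * (norm (eta k *\<^sub>R d))\<^sup>2"
    unfolding \<theta>_Suc d_def using Lipschitz_gradient_descent[OF deriv lipschitz] .
  also have "\<dots> = L (\<theta> k) + eta k * (inner (v k) d - inner e d + (C * eta k / 2) * (norm d)\<^sup>2)"
    by (simp add: Gd power_mult_distrib power2_eq_square algebra_simps)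
  also have "\<dots> \<le> L (\<theta> k) + eta k * ((lam * mu * (norm q)\<^sup>2 + lam * mu * (norm d)\<^sup>2 - 2 * p - 2 * lam * (norm d)\<^sup>2)
      + (kappa / 2 * (norm d)\<^sup>2 + (norm e)\<^sup>2 / (2 * kappa)) + kappa * (norm d)\<^sup>2)"
    using vd' ed mult_right_mono[OF eta_le[of k], of "(norm d)\<^sup>2"] eta_pos[of k]
    by (intro add_left_mono mult_left_mono) auto
  \<comment> \<open>The coefficients of the squared new increment add up as
    \<open>lam * mu - 2 * lam + 3 / 2 * kappa = - lam * mu - kappa / 2\<close>. The part
    \<open>lam * mu\<close> becomes the next momentum term, the rest is dissipation.\<close>
  also have "\<dots> = L (\<theta> k) + lam * mu * eta k * (norm q)\<^sup>2 - lam * mu * eta k * (norm d)\<^sup>2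
      - eta k * (kappa / 2 * (norm d)\<^sup>2 + 2 * p) + eta k * (norm e)\<^sup>2 / (2 * kappa)"
    by (simp add: algebra_simps)
  also have "\<dots> = L (\<theta> k) + lam * mu * eta k * (norm q)\<^sup>2 - lam * mu * eta k * (norm d)\<^sup>2
      - eta k * dissipation k + eta k * (norm e)\<^sup>2 / (2 * kappa)"
    by (simp add: dissipation_def d_def p_def)
  finally have *: "L (\<theta> (Suc k)) \<le> \<dots>" .
  \<comment> \<open>Decreasing steps turn the weight \<open>eta k\<close> of the new momentum term
    into \<open>eta (Suc k)\<close>, so that consecutive steps telescope.\<close>
  have "lam * mu * eta (Suc k) * (norm d)\<^sup>2 \<le> lam * mu * eta k * (norm d)\<^sup>2"
    using lam mu eta_Suc[of k] by (intro mult_right_mono mult_left_mono) auto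
  with * show ?thesis by (simp add: d_def q_def e_def)
qed

text \<open>Telescoping of \<open>lyapunov_step\<close>: the last momentum term is dropped as
  nonnegative, and the first and last values of \<open>L\<close> cost \<open>2 * B\<close>
  together.\<close>

lemma sum_dissipation_le:
  "(\<Sum>k<n. eta k * dissipation k)
    \<le> 2 * B + lam * mu * eta 0 * (norm (\<Delta> 0))\<^sup>2
      + (\<Sum>k<n. eta k * (norm (v k - G (\<theta> k)))\<^sup>2) / (2 * kappa)"
proof -
  have "L (\<theta> n) + lam * mu * eta n * (norm (\<Delta> n))\<^sup>2 + (\<Sum>k<n. eta k * dissipation k)
    \<le> L (\<theta> 0) + lam * mu * eta 0 * (norm (\<Delta> 0))\<^sup>2
      + (\<Sum>k<n. eta k * (norm (v k - G (\<theta> k)))\<^sup>2) / (2 * kappa)"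
  proof (induction n)
    case (Suc n)
    then show ?case using lyapunov_step[of n] by (simp add: add_divide_distrib)
  qed simp
  moreover have "0 \<le> lam * mu * eta n * (norm (\<Delta> n))\<^sup>2"
    using lam mu eta_pos[of n] by simp
  ultimately show ?thesis using bounded[of "\<theta> n"] bounded[of "\<theta> 0"] by linarith
qed

text \<open>The implicit equation paired with the gradient. Of the full squared norm, 1/2 pays for
  the gradient error and 1/16 for each of the two increments, which leaves 3/8. The weight
  \<open>t\<close> of \<open>u_bound\<close> stays free until expectations are taken.\<close>

lemma gradient_step:
  assumes t: "t > 0"
  shows "3 / 8 * (norm (G (\<theta> k)))\<^sup>2 \<le> (norm (v k - G (\<theta> k)))\<^sup>2 / 2
    + 16 * lam\<^sup>2 * ((norm (\<Delta> k))\<^sup>2 + (norm (\<Delta> (Suc k)))\<^sup>2)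
    + t * r k + inner (u k) (\<Delta> (Suc k)) / t"
proof -
  define g where "g = G (\<theta> k)"
  define e where "e = v k - g"
  have aux: "2 * lam * (norm g * norm w) \<le> (norm g)\<^sup>2 / 16 + 16 * lam\<^sup>2 * (norm w)\<^sup>2" for w :: 'a
    using mult_le_weighted_squares[of "1 / 16" "norm g" "2 * lam * norm w"] by (simp add: power_mult_distrib algebra_simps)
  have ge: "- inner g e \<le> (norm g)\<^sup>2 / 2 + (norm e)\<^sup>2 / 2"
    using mult_le_weighted_squares[of "1 / 2" "norm g" "norm e"] norm_cauchy_schwarz[of g "-e"] by simp
  have "(1 / 2) *\<^sub>R v k = (lam * mu) *\<^sub>R \<Delta> k - (lam *\<^sub>R \<Delta> (Suc k) + u k)"
    using implicit[of k] by simp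
  then have "inner g ((1 / 2) *\<^sub>R v k) = inner g ((lam * mu) *\<^sub>R \<Delta> k - (lam *\<^sub>R \<Delta> (Suc k) + u k))" by simp
  then have gv: "inner g (v k) = 2 * lam * mu * inner g (\<Delta> k) - 2 * lam * inner g (\<Delta> (Suc k)) - 2 * inner g (u k)"
    by (simp add: inner_diff_right inner_add_right algebra_simps)
  have "2 * lam * mu * inner g (\<Delta> k) \<le> mu * (2 * lam * (norm g * norm (\<Delta> k)))"
    using norm_cauchy_schwarz[of g "\<Delta> k"] lam mu
    by (simp add: mult.assoc mult.left_commute mult_left_mono)
  also have "\<dots> \<le> 2 * lam * (norm g * norm (\<Delta> k))"
    using lam mu by (intro mult_left_le_one_le) auto
  finally have 1: "2 * lam * mu * inner g (\<Delta> k) \<le> (norm g)\<^sup>2 / 16 + 16 * lam\<^sup>2 * (norm (\<Delta> k))\<^sup>2"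
    using aux[of "\<Delta> k"] by linarith
  have "- (2 * lam * inner g (\<Delta> (Suc k))) \<le> 2 * lam * (norm g * norm (\<Delta> (Suc k)))"
    using mult_left_mono[OF norm_cauchy_schwarz[of g "- \<Delta> (Suc k)"], of "2 * lam"] lam by simp
  then have 2: "- (2 * lam * inner g (\<Delta> (Suc k))) \<le> (norm g)\<^sup>2 / 16 + 16 * lam\<^sup>2 * (norm (\<Delta> (Suc k)))\<^sup>2"
    using aux[of "\<Delta> (Suc k)"] by linarith
  have "inner g (v k) = (norm g)\<^sup>2 + inner g e"
    by (simp add: e_def inner_diff_right power2_norm_eq_inner)
  then show ?thesis
    using 1 2 gv ge u_bound[OF t, of k] unfolding distrib_left
    by (simp add: g_def[symmetric] e_def[symmetric])
qed

text \<open>Everything except the gradient error and \<open>r\<close> is paid for by dissipation, at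
  price \<open>c\<close>: 32 times \<open>lam\<close> squared times the squared increment costs the
  first summand of \<open>c\<close>, and \<open>inner (u k) (\<Delta> (Suc k)) / t\<close> costs
  \<open>1 / (2 * t)\<close>.\<close>

lemma weighted_gradient_sum_le:
  assumes t: "t > 0" and c: "c = 64 * lam\<^sup>2 / kappa + 1 / (2 * t)"
  shows "3 / 8 * (\<Sum>k=1..K. eta k * (norm (G (\<theta> k)))\<^sup>2)
    \<le> c * (2 * B + lam * mu * eta 0 * (norm (\<Delta> 0))\<^sup>2)
      + (1 / 2 + c / (2 * kappa)) * (\<Sum>k\<le>K. eta k * (norm (v k - G (\<theta> k)))\<^sup>2)
      + t * (\<Sum>k=1..K. eta k * r k)"
proof -
  let ?d = "\<lambda>k. (norm (\<Delta> k))\<^sup>2" and ?e = "\<lambda>k. (norm (v k - G (\<theta> k)))\<^sup>2"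
  let ?p = "\<lambda>k. inner (u k) (\<Delta> (Suc k))"
  have sub: "(\<Sum>k=1..K. f k) \<le> (\<Sum>k\<le>K. f k)" if "\<And>k. 0 \<le> f k" for f :: "nat \<Rightarrow> real"
    using that by (intro sum_mono2) auto
  \<comment> \<open>The sum starts at 1, so each \<open>\<Delta> k\<close> in it is the new
    increment of step \<open>k - 1\<close>, and its weight may be raised to
    \<open>eta (k - 1)\<close>.\<close>
  have shift: "(\<Sum>k=1..K. eta k * ?d k) \<le> (\<Sum>k\<le>K. eta k * ?d (Suc k))"
  proof -
    have "(\<Sum>k=1..K. eta k * ?d k) = (\<Sum>k<K. eta (Suc k) * ?d (Suc k))"
      using sum.atLeast1_atMost_eq[of "\<lambda>k. eta k * ?d k" K] by simp
    also have "\<dots> \<le> (\<Sum>k<K. eta k * ?d (Suc k))"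
      using eta_Suc by (intro sum_mono mult_right_mono) auto
    also have "\<dots> \<le> (\<Sum>k\<le>K. eta k * ?d (Suc k))"
      using eta_pos by (intro sum_mono2) (auto simp: less_imp_le)
    finally show ?thesis .
  qed
  have "3 / 8 * (\<Sum>k=1..K. eta k * (norm (G (\<theta> k)))\<^sup>2)
    = (\<Sum>k=1..K. eta k * (3 / 8 * (norm (G (\<theta> k)))\<^sup>2))"
    by (simp add: sum_distrib_left mult.left_commute)
  also have "\<dots> \<le> (\<Sum>k=1..K. eta k * (?e k / 2 + 16 * lam\<^sup>2 * (?d k + ?d (Suc k)) + t * r k + ?p k / t))"
    using gradient_step[OF t] eta_pos by (intro sum_mono mult_left_mono) (auto simp: less_imp_le)
  also have "\<dots> = (\<Sum>k=1..K. eta k * ?e k) / 2 + 16 * lam\<^sup>2 * (\<Sum>k=1..K. eta k * ?d k)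
      + 16 * lam\<^sup>2 * (\<Sum>k=1..K. eta k * ?d (Suc k)) + t * (\<Sum>k=1..K. eta k * r k) + (\<Sum>k=1..K. eta k * ?p k) / t"
    by (simp add: sum_distrib_left sum_divide_distrib sum.distrib[symmetric] algebra_simps)
  also have "\<dots> \<le> (\<Sum>k\<le>K. eta k * ?e k) / 2 + 16 * lam\<^sup>2 * (\<Sum>k\<le>K. eta k * ?d (Suc k))
      + 16 * lam\<^sup>2 * (\<Sum>k\<le>K. eta k * ?d (Suc k)) + t * (\<Sum>k=1..K. eta k * r k) + (\<Sum>k\<le>K. eta k * ?p k) / t"
    using shift t eta_pos u_nonneg
    by (intro add_mono mult_left_mono divide_right_mono sub shift) (auto simp: less_imp_le)
  also have "\<dots> = (\<Sum>k\<le>K. eta k * ?e k) / 2 + t * (\<Sum>k=1..K. eta k * r k)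
      + (\<Sum>k\<le>K. eta k * (32 * lam\<^sup>2 * ?d (Suc k) + ?p k / t))"
    by (simp add: sum_distrib_left sum_divide_distrib sum.distrib[symmetric] algebra_simps)
  also have "(\<Sum>k\<le>K. eta k * (32 * lam\<^sup>2 * ?d (Suc k) + ?p k / t)) \<le> (\<Sum>k\<le>K. eta k * (c * dissipation k))"
  proof (intro sum_mono mult_left_mono)
    fix k
    have p: "?p k \<le> dissipation k / 2" unfolding dissipation_def using kappa_pos by simp
    have "32 * lam\<^sup>2 * ?d (Suc k) + ?p k / t \<le> 32 * lam\<^sup>2 * (2 / kappa * dissipation k) + (dissipation k / 2) / t"
      using t by (intro add_mono mult_left_mono divide_right_mono increment_le_dissipation p) auto
    then show "32 * lam\<^sup>2 * ?d (Suc k) + ?p k / t \<le> c * dissipation k"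
      by (simp add: c algebra_simps)
  qed (use eta_pos in \<open>auto simp: less_imp_le\<close>)
  also have "(\<Sum>k\<le>K. eta k * (c * dissipation k)) = c * (\<Sum>k<Suc K. eta k * dissipation k)"
    by (simp add: sum_distrib_left lessThan_Suc_atMost algebra_simps)
  also have "\<dots> \<le> c * (2 * B + lam * mu * eta 0 * (norm (\<Delta> 0))\<^sup>2 + (\<Sum>k<Suc K. eta k * ?e k) / (2 * kappa))"
    using kappa_pos t by (intro mult_left_mono sum_dissipation_le) (simp add: c)
  finally show ?thesis by (simp add: lessThan_Suc_atMost algebra_simps)
qed

end


section \<open>The regularized linear system\<close>

lemma outer_mult: "outer v w *v x = inner w x *\<^sub>R v"
  by (simp add: outer_def matrix_vector_mult_def vec_eq_iff inner_vec_def sum_distrib_left mult_ac)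

lemma sum_outer_mult:
  "(\<Sum>i\<in>I. outer (w i) (w i)) *v x = (\<Sum>i\<in>I. inner (w i) x *\<^sub>R (w i :: real ^ 'p))"
  by (induction I rule: infinite_finite_induct)
    (simp_all add: matrix_vector_mult_add_rdistrib outer_mult)

lemma batch_S_mult:
  "batch_S \<psi> n \<theta> b *v x =
    (1 / (real n - 1)) *\<^sub>R (\<Sum>i<n. inner (batch_centered_score \<psi> n \<theta> b i) x *\<^sub>R batch_centered_score \<psi> n \<theta> b i)"
  by (simp add: batch_S_def scaleR_matrix_vector_assoc[symmetric] sum_outer_mult)

lemma inner_batch_S:
  "inner y (batch_S \<psi> n \<theta> b *v x) =
    (\<Sum>i<n. inner (batch_centered_score \<psi> n \<theta> b i) x * inner (batch_centered_score \<psi> n \<theta> b i) y) / (real n - 1)"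
  by (simp add: batch_S_mult inner_sum_right inner_commute)

text \<open>A sum of squares over a nonnegative number; for \<open>n = 1\<close> the denominator is
  0 and the quotient is 0 by convention.\<close>

lemma inner_batch_S_nonneg: "n \<ge> 1 \<Longrightarrow> 0 \<le> inner x (batch_S \<psi> n \<theta> b *v x)"
  by (simp add: inner_batch_S sum_nonneg)

text \<open>Young's inequality for the two projections of each sample separately, so no square root
  of the matrix is taken. This is what supplies \<open>u_bound\<close>.\<close>

lemma inner_batch_S_weighted:
  assumes "n \<ge> 1" "t > 0"
  shows "- 2 * inner y (batch_S \<psi> n \<theta> b *v x)
    \<le> t * inner y (batch_S \<psi> n \<theta> b *v y) + inner x (batch_S \<psi> n \<theta> b *v x) / t"
proof -
  have *: "- 2 * (a * c) \<le> t * (c * c) + (a * a) / t" for a c :: real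
    using mult_le_weighted_squares[of t c "- 2 * a"] assms by (simp add: power2_eq_square algebra_simps)
  let ?o = "batch_centered_score \<psi> n \<theta> b"
  have "(\<Sum>i<n. - 2 * (inner (?o i) x * inner (?o i) y))
    \<le> (\<Sum>i<n. t * (inner (?o i) y * inner (?o i) y) + (inner (?o i) x * inner (?o i) x) / t)"
    by (intro sum_mono *)
  then have "(\<Sum>i<n. - 2 * (inner (?o i) x * inner (?o i) y)) / (real n - 1)
    \<le> (\<Sum>i<n. t * (inner (?o i) y * inner (?o i) y) + (inner (?o i) x * inner (?o i) x) / t) / (real n - 1)"
    using assms by (intro divide_right_mono) auto
  then show ?thesis
    unfolding inner_batch_S sum.distrib sum_distrib_left[symmetric] sum_divide_distrib[symmetric] add_divide_distrib
    by (simp add: mult.commute)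
qed

text \<open>The quadratic form of the matrix is at least \<open>lam\<close> times the squared norm,
  so its kernel is trivial.\<close>

lemma regularized_system_invertible:
  assumes "lam > 0" "n \<ge> 1"
  shows "invertible (lam *\<^sub>R mat 1 + batch_S \<psi> n \<theta> b)" (is "invertible ?A")
proof -
  have "x = 0" if "?A *v x = 0" for x
  proof -
    have "0 = inner x (?A *v x)" using that by simp
    also have "\<dots> = lam * (norm x)\<^sup>2 + inner x (batch_S \<psi> n \<theta> b *v x)"
      by (simp add: matrix_vector_mult_add_rdistrib scaleR_matrix_vector_assoc[symmetric] inner_add_right
          power2_norm_eq_inner)
    finally have "lam * (norm x)\<^sup>2 \<le> 0" using inner_batch_S_nonneg[OF assms(2), of x \<psi> \<theta> b] by linarith
    then show "x = 0" using assms by (simp add: mult_le_0_iff)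
  qed
  then show ?thesis by (auto simp: invertible_left_inverse matrix_left_invertible_ker)
qed

text \<open>\<open>matrix_inv\<close> is a choice among candidates, so its defining property has to
  be drawn from the existence of an inverse.\<close>

lemma matrix_inv_mult_vec:
  fixes A :: "real ^ 'n ^ 'n"
  assumes "invertible A"
  shows "A *v (matrix_inv A *v w) = w"
proof -
  have "A ** matrix_inv A = mat 1"
    using assms someI_ex[of "\<lambda>A'. A ** A' = mat 1 \<and> A' ** A = mat 1"]
    unfolding invertible_def matrix_inv_def by blast
  then show ?thesis by (simp add: matrix_vector_mul_assoc)
qed

text \<open>Cramer's rule writes the solution through determinants of the entries, which makes it
  visibly measurable in matrix and right-hand side.\<close>

lemma matrix_inv_mult_vec_cramer:
  fixes A :: "real ^ 'n ^ 'n"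
  assumes "invertible A"
  shows "matrix_inv A *v w = (\<chi> k. det (\<chi> i j. if j = k then w $ i else A $ i $ j) / det A)"
  using assms cramer[of A "matrix_inv A *v w" w] matrix_inv_mult_vec[OF assms, of w]
  by (simp add: invertible_det_nz)


section \<open>Fourth moments and sample covariances\<close>

text \<open>On a probability space \<open>1 + X ^ 4\<close> is integrable, and it dominates all
  lower powers.\<close>

lemma (in prob_space) integrable_lower_powers:
  fixes X :: "'a \<Rightarrow> real"
  assumes [measurable]: "X \<in> borel_measurable M" and X: "integrable M (\<lambda>x. X x ^ 4)"
  shows "integrable M X" "integrable M (\<lambda>x. (X x)\<^sup>2)" "integrable M (\<lambda>x. X x ^ 3)"
proof -
  have int: "integrable M (\<lambda>x. 1 + X x ^ 4)" using X by simp
  have bound: "\<bar>y\<bar> ^ m \<le> 1 + y ^ 4" if "m \<le> 4" for y :: real and m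
  proof (cases "\<bar>y\<bar> \<le> 1")
    case True
    then have "\<bar>y\<bar> ^ m \<le> 1" by (simp add: power_le_one)
    then show ?thesis by (smt (verit) zero_le_even_power' even_numeral zero_le_even_power)
  next
    case False
    then have "\<bar>y\<bar> ^ m \<le> \<bar>y\<bar> ^ 4" using that by (intro power_increasing) auto
    then show ?thesis by simp
  qed
  show "integrable M X"
    by (rule Bochner_Integration.integrable_bound[OF int]) (use bound[of 1] in auto)
  show "integrable M (\<lambda>x. (X x)\<^sup>2)"
    by (rule Bochner_Integration.integrable_bound[OF int]) (use bound[of 2] in \<open>auto simp: power_abs\<close>)
  show "integrable M (\<lambda>x. X x ^ 3)"
    by (rule Bochner_Integration.integrable_bound[OF int]) (use bound[of 3] in \<open>auto simp: power_abs\<close>)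
qed

lemma (in prob_space) expectation_lower_powers_le:
  fixes X :: "'a \<Rightarrow> real"
  assumes [measurable]: "X \<in> borel_measurable M"
    and X: "integrable M (\<lambda>x. X x ^ 4)" "expectation (\<lambda>x. X x ^ 4) \<le> K"
  shows "\<bar>expectation X\<bar> \<le> 1 + K" "expectation (\<lambda>x. (X x)\<^sup>2) \<le> 1 + K"
proof -
  have y2: "y\<^sup>2 \<le> 1 + y ^ 4" for y :: real
    using zero_le_power2[of "y\<^sup>2 - 1/2"] by (simp add: power2_eq_square power4_eq_xxxx algebra_simps)
  have y1: "\<bar>y\<bar> \<le> 1 + y ^ 4" for y :: real
  proof -
    have "\<bar>y\<bar> \<le> (1 + y\<^sup>2) / 2" using zero_le_power2[of "\<bar>y\<bar> - 1"] by (simp add: power2_diff)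
    moreover have "0 \<le> y ^ 4" by simp
    ultimately show ?thesis using y2[of y] by argo
  qed
  have int: "integrable M (\<lambda>x. 1 + X x ^ 4)" using X by simp
  have K: "expectation (\<lambda>x. 1 + X x ^ 4) \<le> 1 + K"
    using X by (simp add: prob_space)
  have "\<bar>expectation X\<bar> \<le> expectation (\<lambda>x. \<bar>X x\<bar>)"
    by (rule integral_abs_bound)
  also have "\<dots> \<le> expectation (\<lambda>x. 1 + X x ^ 4)"
    using integrable_lower_powers(1)[OF assms(1) X(1)] int y1 by (intro integral_mono) auto
  finally show "\<bar>expectation X\<bar> \<le> 1 + K" using K by simp
  have "expectation (\<lambda>x. (X x)\<^sup>2) \<le> expectation (\<lambda>x. 1 + X x ^ 4)"
    using integrable_lower_powers(2)[OF assms(1) X(1)] int y2 by (intro integral_mono) auto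
  then show "expectation (\<lambda>x. (X x)\<^sup>2) \<le> 1 + K" using K by simp
qed

section \<open>Moments of sums of independent variables\<close>

lemma (in prob_space) indep_var_power_integral:
  fixes X Y :: "'a \<Rightarrow> real"
  assumes "indep_var borel X borel Y" "integrable M (\<lambda>x. X x ^ i)" "integrable M (\<lambda>x. Y x ^ j)"
  shows "integrable M (\<lambda>x. X x ^ i * Y x ^ j)"
    and "expectation (\<lambda>x. X x ^ i * Y x ^ j) = expectation (\<lambda>x. X x ^ i) * expectation (\<lambda>x. Y x ^ j)"
proof -
  have "indep_var borel ((\<lambda>x. x ^ i) \<circ> X) borel ((\<lambda>x. x ^ j) \<circ> Y)"
    by (rule indep_var_compose[OF assms(1)]) auto
  then have ind: "indep_var borel (\<lambda>x. X x ^ i) borel (\<lambda>x. Y x ^ j)" by (simp add: comp_def)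
  show "integrable M (\<lambda>x. X x ^ i * Y x ^ j)"
    using indep_var_integrable[OF ind assms(2,3)] .
  show "expectation (\<lambda>x. X x ^ i * Y x ^ j) = expectation (\<lambda>x. X x ^ i) * expectation (\<lambda>x. Y x ^ j)"
    using indep_var_lebesgue_integral[OF ind assms(2,3)] .
qed

text \<open>A new centred variable is independent of the sum so far, so the cross term has mean 0.
  Integrability and the zero mean belong to the conclusion because the induction step needs
  both.\<close>

lemma (in prob_space) indep_sum_second_moment:
  fixes X :: "'i \<Rightarrow> 'a \<Rightarrow> real" and V K :: real
  assumes "finite I" "indep_vars (\<lambda>_. borel) X I"
    and "\<And>i. i \<in> I \<Longrightarrow> integrable M (\<lambda>x. (X i x)\<^sup>2)"
    and "\<And>i. i \<in> I \<Longrightarrow> expectation (X i) = 0"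
    and "\<And>i. i \<in> I \<Longrightarrow> expectation (\<lambda>x. (X i x)\<^sup>2) \<le> V"
  shows "integrable M (\<lambda>x. (\<Sum>i\<in>I. X i x)\<^sup>2) \<and> expectation (\<lambda>x. \<Sum>i\<in>I. X i x) = 0 \<and>
    expectation (\<lambda>x. (\<Sum>i\<in>I. X i x)\<^sup>2) \<le> card I * V"
  using assms
proof (induction I rule: finite_induct)
  case (insert i I)
  define S where "S = (\<lambda>x. \<Sum>i\<in>I. X i x)"
  have meas[measurable]: "X j \<in> borel_measurable M" if "j \<in> insert i I" for j
    using insert.prems(1) that by (auto simp: indep_vars_def)
  have [measurable]: "X i \<in> borel_measurable M" "S \<in> borel_measurable M"
    unfolding S_def by (auto intro!: borel_measurable_sum meas)
  have IH: "integrable M (\<lambda>x. (S x)\<^sup>2)" "expectation S = 0" "expectation (\<lambda>x. (S x)\<^sup>2) \<le> card I * V"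
    using insert.IH[OF indep_vars_subset[OF insert.prems(1)]] insert.prems by (auto simp: S_def)
  have ind: "indep_var borel (X i) borel S"
    unfolding S_def using insert by (intro indep_vars_sum) auto
  have iX: "integrable M (\<lambda>x. (X i x)\<^sup>2)" using insert.prems by auto
  have iX1: "integrable M (X i)" and iS1: "integrable M S"
    using iX IH by (auto intro: square_integrable_imp_integrable)
  have sm: "integrable M (\<lambda>x. X i x * S x)" "expectation (\<lambda>x. X i x * S x) = 0"
    using indep_var_power_integral[OF ind, of 1 1] iX1 iS1 IH by auto
  have eq: "(\<Sum>i\<in>insert i I. X i x)\<^sup>2 = (X i x)\<^sup>2 + 2 * (X i x * S x) + (S x)\<^sup>2" for x
    using insert by (simp add: S_def power2_sum)
  have "expectation (\<lambda>x. (\<Sum>i\<in>insert i I. X i x)\<^sup>2) = expectation (\<lambda>x. (X i x)\<^sup>2) + expectation (\<lambda>x. (S x)\<^sup>2)"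
    unfolding eq using iX sm IH by simp
  also have "\<dots> \<le> V + card I * V" using insert.prems(4)[of i] IH by (intro add_mono) auto
  finally have "expectation (\<lambda>x. (\<Sum>i\<in>insert i I. X i x)\<^sup>2) \<le> card (insert i I) * V"
    using insert by (simp add: algebra_simps)
  moreover have "integrable M (\<lambda>x. (\<Sum>i\<in>insert i I. X i x)\<^sup>2)"
    unfolding eq using iX sm IH by simp
  moreover have "expectation (\<lambda>x. \<Sum>i\<in>insert i I. X i x) = 0"
  proof -
    have "expectation (\<lambda>x. \<Sum>i\<in>insert i I. X i x) = expectation (\<lambda>x. X i x + S x)"
      using insert by (simp add: S_def)
    also have "\<dots> = 0" using iX1 iS1 IH insert.prems(3)[of i] by simp
    finally show ?thesis .
  qed
  ultimately show ?case by blast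
qed auto

text \<open>In the binomial expansion the two odd mixed terms contain a factor of mean 0; only the
  mixed term of squares survives. The sum thus has a fourth moment of order
  \<open>(card I)\<^sup>2\<close>, not of order \<open>card I ^ 4\<close>.\<close>

lemma (in prob_space) indep_sum_fourth_moment:
  fixes X :: "'i \<Rightarrow> 'a \<Rightarrow> real" and V K :: real
  assumes "finite I" "indep_vars (\<lambda>_. borel) X I"
    and "\<And>i. i \<in> I \<Longrightarrow> integrable M (\<lambda>x. X i x ^ 4)"
    and "\<And>i. i \<in> I \<Longrightarrow> expectation (X i) = 0"
    and "\<And>i. i \<in> I \<Longrightarrow> expectation (\<lambda>x. (X i x)\<^sup>2) \<le> V"
    and "\<And>i. i \<in> I \<Longrightarrow> expectation (\<lambda>x. X i x ^ 4) \<le> K"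
  shows "integrable M (\<lambda>x. (\<Sum>i\<in>I. X i x) ^ 4) \<and>
    expectation (\<lambda>x. (\<Sum>i\<in>I. X i x) ^ 4) \<le> card I * K + 3 * (card I)\<^sup>2 * V\<^sup>2"
  using assms
proof (induction I rule: finite_induct)
  case (insert i I)
  define S where "S = (\<lambda>x. \<Sum>i\<in>I. X i x)"
  have meas[measurable]: "X j \<in> borel_measurable M" if "j \<in> insert i I" for j
    using insert.prems(1) that by (auto simp: indep_vars_def)
  have [measurable]: "X i \<in> borel_measurable M" "S \<in> borel_measurable M"
    unfolding S_def by (auto intro!: borel_measurable_sum meas)
  have sub: "indep_vars (\<lambda>_. borel) X I"
    using indep_vars_subset[OF insert.prems(1)] by auto
  have IH: "integrable M (\<lambda>x. S x ^ 4)" "expectation (\<lambda>x. S x ^ 4) \<le> card I * K + 3 * (card I)\<^sup>2 * V\<^sup>2"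
    using insert.IH[OF sub] insert.prems by (auto simp: S_def)
  have S2: "expectation S = 0 \<and> expectation (\<lambda>x. (S x)\<^sup>2) \<le> card I * V"
    unfolding S_def using insert.prems meas
    by (intro indep_sum_second_moment[OF insert.hyps(1) sub, of V, THEN conjunct2] integrable_lower_powers(2)) auto
  have ind: "indep_var borel (X i) borel S"
    unfolding S_def using insert by (intro indep_vars_sum) auto
  have iX: "integrable M (\<lambda>x. X i x ^ 4)" using insert.prems by auto
  note iXs = integrable_lower_powers[OF _ iX, simplified]
  note iSs = integrable_lower_powers[OF _ IH(1), simplified]
  have m13: "integrable M (\<lambda>x. X i x * S x ^ 3)" "expectation (\<lambda>x. X i x * S x ^ 3) = 0"
    using indep_var_power_integral[OF ind, of 1 3] iXs iSs insert.prems(3)[of i] by auto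
  have m31: "integrable M (\<lambda>x. X i x ^ 3 * S x)" "expectation (\<lambda>x. X i x ^ 3 * S x) = 0"
    using indep_var_power_integral[OF ind, of 3 1] iXs iSs S2 by auto
  have m22: "integrable M (\<lambda>x. (X i x)\<^sup>2 * (S x)\<^sup>2)"
    "expectation (\<lambda>x. (X i x)\<^sup>2 * (S x)\<^sup>2) = expectation (\<lambda>x. (X i x)\<^sup>2) * expectation (\<lambda>x. (S x)\<^sup>2)"
    using indep_var_power_integral[OF ind, of 2 2] iXs iSs by auto
  have eq: "(\<Sum>i\<in>insert i I. X i x) ^ 4 =
      X i x ^ 4 + 4 * (X i x ^ 3 * S x) + 6 * ((X i x)\<^sup>2 * (S x)\<^sup>2) + 4 * (X i x * S x ^ 3) + S x ^ 4" for x
    using insert by (simp add: S_def power2_eq_square power3_eq_cube power4_eq_xxxx algebra_simps)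
  have "expectation (\<lambda>x. (\<Sum>i\<in>insert i I. X i x) ^ 4) = expectation (\<lambda>x. X i x ^ 4)
      + 6 * (expectation (\<lambda>x. (X i x)\<^sup>2) * expectation (\<lambda>x. (S x)\<^sup>2)) + expectation (\<lambda>x. S x ^ 4)"
    unfolding eq using iX m13 m31 m22 IH by simp
  also have "\<dots> \<le> K + 6 * (V * (card I * V)) + (card I * K + 3 * (card I)\<^sup>2 * V\<^sup>2)"
  proof (intro add_mono mult_left_mono mult_mono)
    have "0 \<le> expectation (\<lambda>x. (X i x)\<^sup>2)" by (rule Bochner_Integration.integral_nonneg) simp
    also have "\<dots> \<le> V" using insert.prems(4)[of i] by simp
    finally show "0 \<le> V" .
  qed (use insert.prems(4,5)[of i] IH S2 in auto)
  \<comment> \<open>With \<open>m = card I\<close>, the increase of \<open>3 * m\<^sup>2\<close> to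
    \<open>3 * (m + 1)\<^sup>2\<close> is \<open>6 * m + 3\<close>, which covers the mixed
    term.\<close>
  also have "\<dots> \<le> card (insert i I) * K + 3 * (card (insert i I))\<^sup>2 * V\<^sup>2"
    using insert by (simp add: power2_eq_square algebra_simps)
  finally have "expectation (\<lambda>x. (\<Sum>i\<in>insert i I. X i x) ^ 4) \<le> card (insert i I) * K + 3 * (card (insert i I))\<^sup>2 * V\<^sup>2" .
  moreover have "integrable M (\<lambda>x. (\<Sum>i\<in>insert i I. X i x) ^ 4)"
    unfolding eq using iX m13 m31 m22 IH by simp
  ultimately show ?case by blast
qed auto

text \<open>Independence means that the joint law is the product of the marginals; for the
  coordinates of a product measure both are that measure itself.\<close>

lemma (in prob_space) indep_vars_PiM_components:
  assumes "I \<noteq> {}" and f: "\<And>i. i \<in> I \<Longrightarrow> f i \<in> measurable M (N i)"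
  shows "prob_space.indep_vars (PiM I (\<lambda>_. M)) N (\<lambda>i x. f i (x i)) I"
proof -
  interpret P: prob_space "PiM I (\<lambda>_. M)" by (intro prob_space_PiM prob_space_axioms)
  have "P.indep_vars (\<lambda>_. M) (\<lambda>i x. x i) I"
  proof (subst P.indep_vars_iff_distr_eq_PiM'[OF assms(1)])
    have "distr (PiM I (\<lambda>_. M)) (PiM I (\<lambda>_. M)) (\<lambda>x. \<lambda>i\<in>I. x i) = distr (PiM I (\<lambda>_. M)) (PiM I (\<lambda>_. M)) (\<lambda>x. x)"
      by (intro distr_cong) (auto simp: space_PiM PiE_restrict)
    also have "\<dots> = PiM I (\<lambda>_. M)" by simp
    also have "\<dots> = PiM I (\<lambda>i. distr (PiM I (\<lambda>_. M)) M (\<lambda>x. x i))"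
      by (intro PiM_cong refl) (simp add: distr_PiM_component[OF prob_space_axioms])
    finally show "distr (PiM I (\<lambda>_. M)) (PiM I (\<lambda>_. M)) (\<lambda>x. \<lambda>i\<in>I. x i) = PiM I (\<lambda>i. distr (PiM I (\<lambda>_. M)) M (\<lambda>x. x i))" .
  qed simp
  then show ?thesis by (rule P.indep_vars_compose2[OF _ f])
qed

lemma (in prob_space)
  fixes f :: "'a \<Rightarrow> real"
  assumes i: "i \<in> I" and [measurable]: "f \<in> borel_measurable M"
  shows integrable_PiM_component: "integrable (PiM I (\<lambda>_. M)) (\<lambda>x. f (x i)) \<longleftrightarrow> integrable M f"
    and integral_PiM_component: "(\<integral>x. f (x i) \<partial>PiM I (\<lambda>_. M)) = expectation f"
proof -
  have M: "M = distr (PiM I (\<lambda>_. M)) M (\<lambda>x. x i)"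
    using i by (simp add: distr_PiM_component[OF prob_space_axioms])
  show "integrable (PiM I (\<lambda>_. M)) (\<lambda>x. f (x i)) \<longleftrightarrow> integrable M f"
    using i by (subst (2) M, subst integrable_distr_eq) auto
  show "(\<integral>x. f (x i) \<partial>PiM I (\<lambda>_. M)) = expectation f"
    using i by (subst (2) M, subst integral_distr) auto
qed

section \<open>Sample covariances and their error\<close>

lemma sum_centered_products:
  fixes f h :: "nat \<Rightarrow> real"
  assumes "n > 0"
  shows "(\<Sum>i<n. (f i - (\<Sum>j<n. f j) / n) * (h i - (\<Sum>j<n. h j) / n))
    = (\<Sum>i<n. f i * h i) - (\<Sum>i<n. f i) * (\<Sum>i<n. h i) / n"
proof -
  define A where "A = (\<Sum>j<n. f j)"
  define B where "B = (\<Sum>j<n. h j)"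
  have "(\<Sum>i<n. (f i - A / n) * (h i - B / n)) = (\<Sum>i<n. f i * h i - A / n * h i - B / n * f i + A * B / (n * n))"
    by (simp add: algebra_simps)
  also have "\<dots> = (\<Sum>i<n. f i * h i) - A / n * B - B / n * A + n * (A * B / (n * n))"
    by (simp add: sum.distrib sum_subtractf sum_distrib_left A_def B_def)
  also have "\<dots> = (\<Sum>i<n. f i * h i) - A * B / n" using assms by (simp add: field_simps)
  finally show ?thesis by (simp add: A_def B_def)
qed

text \<open>The factor 8 comes from the convexity bound for a fourth power of a difference, and
  \<open>1 + K\<close> bounds the absolute mean.\<close>

definition centered_moment_bound :: "real \<Rightarrow> real" where
  "centered_moment_bound K = 8 * (K + (1 + K) ^ 4)"

text \<open>The factor 60 is the sum of 24, from the i.i.d. average and the bias, and 36, from the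
  product of sample means.\<close>

definition covariance_error_bound :: "real \<Rightarrow> real" where
  "covariance_error_bound K = 60 * (centered_moment_bound K + (1 + centered_moment_bound K)\<^sup>2)"

lemma (in prob_space) centered_fourth_moment:
  fixes a :: "'a \<Rightarrow> real"
  assumes [measurable]: "a \<in> borel_measurable M"
    and a: "integrable M (\<lambda>x. a x ^ 4)" "expectation (\<lambda>x. a x ^ 4) \<le> K"
  shows "integrable M (\<lambda>x. (a x - expectation a) ^ 4)"
    and "expectation (\<lambda>x. (a x - expectation a) ^ 4) \<le> centered_moment_bound K"
proof -
  define m where "m = expectation a"
  have sq: "(u - v)\<^sup>2 \<le> 2 * (u\<^sup>2 + v\<^sup>2)" for u v :: real
    using zero_le_power2[of "u + v"] by (simp add: power2_sum power2_diff)
  have bound: "(u - m) ^ 4 \<le> 8 * (u ^ 4 + m ^ 4)" for u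
  proof -
    have "(u - m) ^ 4 = ((u - m)\<^sup>2)\<^sup>2" by simp
    also have "\<dots> \<le> (2 * (u\<^sup>2 + m\<^sup>2))\<^sup>2" by (intro power_mono sq) simp
    also have "\<dots> = 4 * (u\<^sup>2 + m\<^sup>2)\<^sup>2" unfolding power_mult_distrib by simp
    also have "(u\<^sup>2 + m\<^sup>2)\<^sup>2 \<le> 2 * ((u\<^sup>2)\<^sup>2 + (m\<^sup>2)\<^sup>2)" using sq[of "u\<^sup>2" "- m\<^sup>2"] by simp
    finally show ?thesis by simp
  qed
  have int: "integrable M (\<lambda>x. 8 * (a x ^ 4 + m ^ 4))" using a by simp
  show i: "integrable M (\<lambda>x. (a x - expectation a) ^ 4)" unfolding m_def[symmetric]
    by (rule Bochner_Integration.integrable_bound[OF int]) (use bound in auto)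
  have "m ^ 4 = \<bar>m\<bar> ^ 4" by simp
  also have "\<dots> \<le> (1 + K) ^ 4"
    unfolding m_def using expectation_lower_powers_le(1)[OF assms] by (intro power_mono) auto
  finally have m: "m ^ 4 \<le> (1 + K) ^ 4" .
  have "expectation (\<lambda>x. (a x - m) ^ 4) \<le> expectation (\<lambda>x. 8 * (a x ^ 4 + m ^ 4))"
    using i int bound by (intro integral_mono) (auto simp: m_def)
  also have "\<dots> = 8 * (expectation (\<lambda>x. a x ^ 4) + m ^ 4)" using a by (simp add: prob_space)
  also have "\<dots> \<le> centered_moment_bound K" unfolding centered_moment_bound_def using a m by simp
  finally show "expectation (\<lambda>x. (a x - expectation a) ^ 4) \<le> centered_moment_bound K"
    by (simp add: m_def)
qed

text \<open>
  With centred summands the error of the sample covariance splits into an average of i.i.d. terms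
  and the product of the two sample means, which is controlled by fourth moments of sums.
\<close>

lemma (in prob_space) sample_covariance_error:
  fixes a b :: "'a \<Rightarrow> real" and n :: nat
  assumes n: "n \<ge> 2"
    and [measurable]: "a \<in> borel_measurable M" "b \<in> borel_measurable M"
    and a: "integrable M (\<lambda>x. a x ^ 4)" "expectation (\<lambda>x. a x ^ 4) \<le> K"
    and b: "integrable M (\<lambda>x. b x ^ 4)" "expectation (\<lambda>x. b x ^ 4) \<le> K"
  defines "err \<equiv> \<lambda>x. (\<Sum>i<n. (a (x i) - (\<Sum>j<n. a (x j)) / n) * (b (x i) - (\<Sum>j<n. b (x j)) / n)) / (real n - 1)
      - expectation (\<lambda>y. (a y - expectation a) * (b y - expectation b))"
  shows "integrable (PiM {..<n} (\<lambda>_. M)) (\<lambda>x. (err x)\<^sup>2)"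
    and "(\<integral>x. (err x)\<^sup>2 \<partial>PiM {..<n} (\<lambda>_. M)) \<le> covariance_error_bound K / n"
proof -
  interpret P: prob_space "PiM {..<n} (\<lambda>_. M)" by (intro prob_space_PiM prob_space_axioms)
  define f where "f = (\<lambda>y. a y - expectation a)"
  define h where "h = (\<lambda>y. b y - expectation b)"
  define c where "c = expectation (\<lambda>y. f y * h y)"
  define K' where "K' = centered_moment_bound K"
  have [measurable]: "f \<in> borel_measurable M" "h \<in> borel_measurable M" by (simp_all add: f_def h_def)
  have f4: "integrable M (\<lambda>x. f x ^ 4)" "expectation (\<lambda>x. f x ^ 4) \<le> K'"
    unfolding f_def K'_def using centered_fourth_moment[OF assms(2) a] .
  have h4: "integrable M (\<lambda>x. h x ^ 4)" "expectation (\<lambda>x. h x ^ 4) \<le> K'"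
    unfolding h_def K'_def using centered_fourth_moment[OF assms(3) b] .
  have mean: "expectation f = 0" "expectation h = 0"
    using integrable_lower_powers(1)[OF _ a(1)] integrable_lower_powers(1)[OF _ b(1)]
    by (simp_all add: f_def h_def prob_space)
  have fh_le: "(u * v)\<^sup>2 \<le> (u ^ 4 + v ^ 4) / 2" for u v :: real
    using zero_le_power2[of "u\<^sup>2 - v\<^sup>2"] by (simp add: power2_diff power_mult_distrib)
  have int2: "integrable M (\<lambda>y. (f y ^ 4 + h y ^ 4) / 2)" using f4 h4 by simp
  have fh2: "integrable M (\<lambda>y. (f y * h y)\<^sup>2)"
    by (rule Bochner_Integration.integrable_bound[OF int2]) (use fh_le in auto)
  have fh: "integrable M (\<lambda>y. f y * h y)" by (rule square_integrable_imp_integrable[OF _ fh2]) simp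
  have "expectation (\<lambda>y. (f y * h y)\<^sup>2) \<le> expectation (\<lambda>y. (f y ^ 4 + h y ^ 4) / 2)"
    using fh2 int2 fh_le by (intro integral_mono) auto
  also have "\<dots> = (expectation (\<lambda>y. f y ^ 4) + expectation (\<lambda>y. h y ^ 4)) / 2"
    using f4(1) h4(1) by simp
  also have "\<dots> \<le> K'" using f4(2) h4(2) by argo
  finally have fh2_le: "expectation (\<lambda>y. (f y * h y)\<^sup>2) \<le> K'" .
  have var: "expectation (\<lambda>y. (f y * h y - c)\<^sup>2) = expectation (\<lambda>y. (f y * h y)\<^sup>2) - c\<^sup>2"
    unfolding c_def using fh fh2 by (intro variance_eq) auto
  have Z2: "expectation (\<lambda>y. (f y * h y - c)\<^sup>2) \<le> K'" unfolding var using fh2_le zero_le_power2[of c] by linarith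
  have "0 \<le> expectation (\<lambda>y. (f y * h y - c)\<^sup>2)" by (rule Bochner_Integration.integral_nonneg) simp
  with var fh2_le have c2: "c\<^sup>2 \<le> K'" by simp
  have K'0: "0 \<le> K'" by (rule order_trans[OF zero_le_power2 c2])

  let ?Z = "\<lambda>x. \<Sum>i<n. f (x i) * h (x i) - c" and ?A = "\<lambda>x. \<Sum>i<n. f (x i)" and ?B = "\<lambda>x. \<Sum>i<n. h (x i)"
  have ne: "{..<n} \<noteq> {}" using n by (simp add: lessThan_empty_iff)
  have intZ: "integrable M (\<lambda>y. (f y * h y - c)\<^sup>2)" using fh2 fh by (simp add: power2_diff)
  have Z: "integrable (PiM {..<n} (\<lambda>_. M)) (\<lambda>x. (?Z x)\<^sup>2) \<and> P.expectation (\<lambda>x. ?Z x) = 0 \<and>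
      P.expectation (\<lambda>x. (?Z x)\<^sup>2) \<le> card {..<n} * K'"
  proof (rule P.indep_sum_second_moment)
    show "P.indep_vars (\<lambda>_. borel) (\<lambda>i x. f (x i) * h (x i) - c) {..<n}"
      by (rule indep_vars_PiM_components[OF ne, of "\<lambda>_ y. f y * h y - c"]) simp
    show "integrable (PiM {..<n} (\<lambda>_. M)) (\<lambda>x. (f (x i) * h (x i) - c)\<^sup>2)" if "i \<in> {..<n}" for i
      using integrable_PiM_component[OF that, of "\<lambda>y. (f y * h y - c)\<^sup>2"] intZ by simp
    show "P.expectation (\<lambda>x. f (x i) * h (x i) - c) = 0" if "i \<in> {..<n}" for i
      using integral_PiM_component[OF that, of "\<lambda>y. f y * h y - c"] fh by (simp add: c_def prob_space)
    show "P.expectation (\<lambda>x. (f (x i) * h (x i) - c)\<^sup>2) \<le> K'" if "i \<in> {..<n}" for i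
      using integral_PiM_component[OF that, of "\<lambda>y. (f y * h y - c)\<^sup>2"] Z2 by simp
  qed simp
  \<comment> \<open>To be used for \<open>f\<close> and for \<open>h\<close>: a fourth moment of
    order \<open>n\<^sup>2\<close>, multiplied by the prefactor of order \<open>1 / n ^ 4\<close>
    below, contributes at order \<open>1 / n\<^sup>2\<close>.\<close>
  have four: "integrable (PiM {..<n} (\<lambda>_. M)) (\<lambda>x. (\<Sum>i<n. g (x i)) ^ 4) \<and>
      P.expectation (\<lambda>x. (\<Sum>i<n. g (x i)) ^ 4) \<le> card {..<n} * K' + 3 * (card {..<n})\<^sup>2 * (1 + K')\<^sup>2"
    if [measurable]: "g \<in> borel_measurable M" and g: "integrable M (\<lambda>x. g x ^ 4)" "expectation (\<lambda>x. g x ^ 4) \<le> K'"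
      "expectation g = 0" for g :: "'a \<Rightarrow> real"
  proof (rule P.indep_sum_fourth_moment)
    show "P.indep_vars (\<lambda>_. borel) (\<lambda>i x. g (x i)) {..<n}"
      by (rule indep_vars_PiM_components[OF ne, of "\<lambda>_. g"]) simp
    show "integrable (PiM {..<n} (\<lambda>_. M)) (\<lambda>x. g (x i) ^ 4)" if "i \<in> {..<n}" for i
      using integrable_PiM_component[OF that, of "\<lambda>y. g y ^ 4"] g by simp
    show "P.expectation (\<lambda>x. g (x i)) = 0" if "i \<in> {..<n}" for i
      using integral_PiM_component[OF that, of g] g by simp
    show "P.expectation (\<lambda>x. (g (x i))\<^sup>2) \<le> 1 + K'" if "i \<in> {..<n}" for i
      using integral_PiM_component[OF that, of "\<lambda>y. (g y)\<^sup>2"] expectation_lower_powers_le(2)[OF _ g(1,2)] by simp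
    show "P.expectation (\<lambda>x. g (x i) ^ 4) \<le> K'" if "i \<in> {..<n}" for i
      using integral_PiM_component[OF that, of "\<lambda>y. g y ^ 4"] g by simp
  qed simp
  note A = four[OF _ f4 mean(1), simplified] and B = four[OF _ h4 mean(2), simplified]

  let ?F = "\<lambda>x. 12 / (real n)\<^sup>2 * (?Z x)\<^sup>2 + 12 / (real n)\<^sup>2 * c\<^sup>2 + 6 / real n ^ 4 * (?A x ^ 4 + ?B x ^ 4)"
  have err: "(err x)\<^sup>2 \<le> ?F x" for x
  proof -
    have a: "a (x i) - (\<Sum>j<n. a (x j)) / n = f (x i) - ?A x / n" for i
      using n by (simp add: f_def sum_subtractf field_simps)
    have b: "b (x i) - (\<Sum>j<n. b (x j)) / n = h (x i) - ?B x / n" for i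
      using n by (simp add: h_def sum_subtractf field_simps)
    have "err x = ((\<Sum>i<n. f (x i) * h (x i)) - ?A x * ?B x / n) / (real n - 1) - c"
      unfolding err_def a b using n sum_centered_products[of n "\<lambda>i. f (x i)" "\<lambda>i. h (x i)"]
      by (simp add: c_def f_def h_def)
    also have "(\<Sum>i<n. f (x i) * h (x i)) = ?Z x + n * c" by (simp add: sum_subtractf)
    \<comment> \<open>Because the normalization is \<open>n - 1\<close>, subtracting
      \<open>c\<close> leaves one copy of \<open>c\<close> over:
      \<open>n * c - (n - 1) * c\<close>.\<close>
    also have "(?Z x + n * c - ?A x * ?B x / n) / (real n - 1) - c
      = (?Z x + c - ?A x * ?B x / n) / (real n - 1)"
    proof -
      have "(z + n * c - w) / (real n - 1) - c = (z + c - w) / (real n - 1)" for z w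
        using n by (simp add: field_simps)
      then show ?thesis .
    qed
    finally have e: "(err x)\<^sup>2 = (?Z x + c - ?A x * ?B x / n)\<^sup>2 / (real n - 1)\<^sup>2" by (simp add: power_divide)
    have three: "(u + v - w)\<^sup>2 \<le> 3 * (u\<^sup>2 + v\<^sup>2 + w\<^sup>2)" for u v w :: real
      using zero_le_power2[of "u - v"] zero_le_power2[of "u + w"] zero_le_power2[of "v + w"]
      by (simp add: power2_eq_square algebra_simps)
    \<comment> \<open>Since \<open>n \<ge> 2\<close>, the denominator \<open>n - 1\<close> is at
      least \<open>n / 2\<close>; squaring costs a factor 4 and the three-term split a factor 3,
      hence 12.\<close>
    have "(err x)\<^sup>2 \<le> (3 * ((?Z x)\<^sup>2 + c\<^sup>2 + (?A x * ?B x / n)\<^sup>2)) / (real n / 2)\<^sup>2"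
      unfolding e using n by (intro frac_le three power_mono) (auto simp: sum_nonneg)
    also have "\<dots> = 12 / (real n)\<^sup>2 * ((?Z x)\<^sup>2 + c\<^sup>2 + (?A x * ?B x)\<^sup>2 / (real n)\<^sup>2)"
      by (simp add: power_divide)
    also have "\<dots> \<le> 12 / (real n)\<^sup>2 * ((?Z x)\<^sup>2 + c\<^sup>2 + ((?A x ^ 4 + ?B x ^ 4) / 2) / (real n)\<^sup>2)"
      by (intro mult_left_mono add_left_mono divide_right_mono fh_le) auto
    also have "\<dots> = ?F x"
    proof -
      have "12 / (real n)\<^sup>2 * (z + w + (y / 2) / (real n)\<^sup>2)
        = 12 / (real n)\<^sup>2 * z + 12 / (real n)\<^sup>2 * w + 6 / real n ^ 4 * y" for w y z
        by (simp add: distrib_left power2_eq_square power4_eq_xxxx)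
      then show ?thesis .
    qed
    finally show ?thesis .
  qed
  have intF: "integrable (PiM {..<n} (\<lambda>_. M)) ?F" using Z A B by auto
  have [measurable]: "err \<in> borel_measurable (PiM {..<n} (\<lambda>_. M))" unfolding err_def by measurable
  show int: "integrable (PiM {..<n} (\<lambda>_. M)) (\<lambda>x. (err x)\<^sup>2)"
    by (rule Bochner_Integration.integrable_bound[OF intF]) (use err in \<open>auto intro: order_trans[OF _ abs_ge_self]\<close>)
  let ?S = "n * K' + 3 * (real n)\<^sup>2 * (1 + K')\<^sup>2"
  have S: "?S \<le> 3 * (real n)\<^sup>2 * (K' + (1 + K')\<^sup>2)"
  proof -
    have "n * K' \<le> 3 * (real n)\<^sup>2 * K'" using n K'0 by (intro mult_right_mono) (auto simp: power2_eq_square)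
    then show ?thesis by (simp add: algebra_simps)
  qed
  have "P.expectation (\<lambda>x. (err x)\<^sup>2) \<le> P.expectation ?F" using int intF err by (intro integral_mono) auto
  also have "\<dots> = 12 / (real n)\<^sup>2 * P.expectation (\<lambda>x. (?Z x)\<^sup>2) + 12 / (real n)\<^sup>2 * c\<^sup>2
      + 6 / real n ^ 4 * (P.expectation (\<lambda>x. ?A x ^ 4) + P.expectation (\<lambda>x. ?B x ^ 4))"
    using Z A B by (simp add: P.prob_space)
  also have "\<dots> \<le> 12 / (real n)\<^sup>2 * (n * K') + 12 / (real n)\<^sup>2 * (n * K')
      + 6 / real n ^ 4 * (3 * (real n)\<^sup>2 * (K' + (1 + K')\<^sup>2) + 3 * (real n)\<^sup>2 * (K' + (1 + K')\<^sup>2))"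
  proof (intro add_mono mult_left_mono)
    have "1 * K' \<le> n * K'" using n K'0 by (intro mult_right_mono) auto
    then show "c\<^sup>2 \<le> n * K'" using c2 by linarith
    show "P.expectation (\<lambda>x. (?Z x)\<^sup>2) \<le> n * K'" using Z by simp
    show "P.expectation (\<lambda>x. ?A x ^ 4) \<le> 3 * (real n)\<^sup>2 * (K' + (1 + K')\<^sup>2)"
      by (rule order_trans[OF _ S]) (use A in blast)
    show "P.expectation (\<lambda>x. ?B x ^ 4) \<le> 3 * (real n)\<^sup>2 * (K' + (1 + K')\<^sup>2)"
      by (rule order_trans[OF _ S]) (use B in blast)
  qed auto
  also have "\<dots> = 24 * K' / n + 36 * (K' + (1 + K')\<^sup>2) / (real n)\<^sup>2"
    using n by (simp add: power2_eq_square power4_eq_xxxx field_simps)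
  \<comment> \<open>The product of the sample means is of the higher order
    \<open>1 / n\<^sup>2\<close>; it is weakened to \<open>1 / n\<close> here, so that a single rate
    remains.\<close>
  also have "\<dots> \<le> 24 * K' / n + 36 * (K' + (1 + K')\<^sup>2) / n"
    using n K'0 by (intro add_left_mono divide_left_mono) (auto simp: power2_eq_square)
  also have "\<dots> \<le> covariance_error_bound K / n"
    using n K'0 by (simp add: covariance_error_bound_def K'_def divide_right_mono add_divide_distrib[symmetric])
  finally show "P.expectation (\<lambda>x. (err x)\<^sup>2) \<le> covariance_error_bound K / n" .
qed

text \<open>A pointwise domination of the product by fourth powers. It makes the true gradient well
  defined coordinate by coordinate and bounded uniformly in the parameter.\<close>

lemma (in prob_space) covariance_bounded:
  fixes a b :: "'a \<Rightarrow> real"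
  assumes [measurable]: "a \<in> borel_measurable M" "b \<in> borel_measurable M"
    and a: "integrable M (\<lambda>x. a x ^ 4)" "expectation (\<lambda>x. a x ^ 4) \<le> K"
    and b: "integrable M (\<lambda>x. b x ^ 4)" "expectation (\<lambda>x. b x ^ 4) \<le> K"
  shows "integrable M (\<lambda>y. (a y - expectation a) * (b y - expectation b))"
    and "\<bar>expectation (\<lambda>y. (a y - expectation a) * (b y - expectation b))\<bar> \<le> 1 + centered_moment_bound K"
proof -
  let ?f = "\<lambda>y. a y - expectation a" and ?h = "\<lambda>y. b y - expectation b"
  note f = centered_fourth_moment[OF assms(1) a] and h = centered_fourth_moment[OF assms(2) b]
  have le: "\<bar>u * v\<bar> \<le> 1 + (u ^ 4 + v ^ 4) / 2" for u v :: real
  proof -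
    define p q where "p = u\<^sup>2" and "q = v\<^sup>2"
    have "2 * (\<bar>u\<bar> * \<bar>v\<bar>) \<le> p + q"
      using zero_le_power2[of "\<bar>u\<bar> - \<bar>v\<bar>"] by (simp add: power2_diff p_def q_def)
    moreover have "2 * w \<le> 1 + w\<^sup>2" for w :: real
      using zero_le_power2[of "w - 1"] by (simp add: power2_diff)
    from this[of p] this[of q] have "2 * p + 2 * q \<le> 2 + (p\<^sup>2 + q\<^sup>2)" by linarith
    moreover have "0 \<le> p" "0 \<le> q" by (simp_all add: p_def q_def)
    ultimately have "2 * (\<bar>u\<bar> * \<bar>v\<bar>) \<le> 2 + (p\<^sup>2 + q\<^sup>2)" by linarith
    then show ?thesis by (simp add: p_def q_def abs_mult field_simps)
  qed
  have int: "integrable M (\<lambda>y. 1 + (?f y ^ 4 + ?h y ^ 4) / 2)" using f(1) h(1) by simp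
  show i: "integrable M (\<lambda>y. ?f y * ?h y)"
  proof (rule Bochner_Integration.integrable_bound[OF int])
    have "norm (?f y * ?h y) \<le> norm (1 + (?f y ^ 4 + ?h y ^ 4) / 2)" for y
      unfolding real_norm_def by (rule order_trans[OF le abs_ge_self])
    then show "AE y in M. norm (?f y * ?h y) \<le> norm (1 + (?f y ^ 4 + ?h y ^ 4) / 2)" by simp
  qed measurable
  have "\<bar>expectation (\<lambda>y. ?f y * ?h y)\<bar> \<le> expectation (\<lambda>y. \<bar>?f y * ?h y\<bar>)" by (rule integral_abs_bound)
  also have "\<dots> \<le> expectation (\<lambda>y. 1 + (?f y ^ 4 + ?h y ^ 4) / 2)"
    by (rule integral_mono[OF integrable_abs[OF i] int le])
  also have "\<dots> = 1 + (expectation (\<lambda>y. ?f y ^ 4) + expectation (\<lambda>y. ?h y ^ 4)) / 2"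
    using f(1) h(1) by (simp add: prob_space)
  also have "\<dots> \<le> 1 + centered_moment_bound K" using add_mono[OF f(2) h(2)] by (simp add: field_simps)
  finally show "\<bar>expectation (\<lambda>y. ?f y * ?h y)\<bar> \<le> 1 + centered_moment_bound K" .
qed


section \<open>Freezing the past\<close>

lemma sets_PiM_finite_rectangles:
  assumes "finite I"
  shows "sets (PiM I M) = sigma_sets (space (PiM I M)) {Pi\<^sub>E I A | A. \<forall>i\<in>I. A i \<in> sets (M i)}"
  using assms by (simp add: sets_PiM prod_algebra_eq_finite space_PiM Pi_def Ball_def)

lemma Int_stable_rectangles: "Int_stable {Pi\<^sub>E I A | A. \<forall>i\<in>I. A i \<in> sets (M i)}"
proof (rule Int_stableI, clarify)
  fix A B assume "\<forall>i\<in>I. A i \<in> sets (M i)" "\<forall>i\<in>I. B i \<in> sets (M i)"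
  then show "\<exists>C. Pi\<^sub>E I A \<inter> Pi\<^sub>E I B = Pi\<^sub>E I C \<and> (\<forall>i\<in>I. C i \<in> sets (M i))"
    by (intro exI[of _ "\<lambda>i. A i \<inter> B i"]) (auto simp: PiE_Int)
qed

lemma rectangles_into_space:
  "{Pi\<^sub>E I A | A. \<forall>i\<in>I. A i \<in> sets (M i)} \<subseteq> Pow (space (PiM I M))"
  by (auto simp: space_PiM PiE_iff intro: subsetD[OF sets.sets_into_space])

lemma space_PiM_rectangle:
  "space (PiM I M) \<in> {Pi\<^sub>E I A | A. \<forall>i\<in>I. A i \<in> sets (M i)}"
proof -
  have "\<forall>i\<in>I. space (M i) \<in> sets (M i)" by simp
  then show ?thesis unfolding space_PiM by blast
qed

text \<open>Given \<open>F\<close>, the variable \<open>T\<close> is constant and \<open>Y\<close>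
  has law \<open>K (T \<omega>)\<close>. The proof identifies the joint law of \<open>T\<close> and
  \<open>Y\<close> with the law of \<open>T\<close> followed by the kernel. It is enough to compare
  them on rectangles, so \<open>cond\<close> is asked only for a generating pi-system, with a null
  set that may depend on \<open>A\<close>.\<close>

lemma (in prob_space) nn_integral_freezing:
  fixes T :: "'a \<Rightarrow> 't" and Y :: "'a \<Rightarrow> 's"
  assumes F: "subalgebra M F"
    and T: "T \<in> measurable F N" and Y[measurable]: "Y \<in> measurable M S"
    and K[measurable]: "K \<in> measurable N (prob_algebra S)"
    and S: "sets S = sigma_sets (space S) G" and G: "Int_stable G" "G \<subseteq> Pow (space S)" "space S \<in> G"
    and cond: "\<And>A. A \<in> G \<Longrightarrow>
      AE \<omega> in M. real_cond_exp M F (indicator (Y -` A \<inter> space M)) \<omega> = measure (K (T \<omega>)) A"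
    and f[measurable]: "f \<in> borel_measurable (N \<Otimes>\<^sub>M S)"
  shows "(\<integral>\<^sup>+\<omega>. f (T \<omega>, Y \<omega>) \<partial>M) = (\<integral>\<^sup>+\<omega>. (\<integral>\<^sup>+y. f (T \<omega>, y) \<partial>K (T \<omega>)) \<partial>M)"
proof -
  interpret F: finite_measure_subalgebra M F
    using F by unfold_locales
  have T'[measurable]: "T \<in> measurable M N" by (rule measurable_from_subalg[OF F T])
  have GS: "A \<in> sets S" if "A \<in> G" for A using that by (simp add: S)
  have KS: "sets (K t) = sets S" "prob_space (K t)" if "t \<in> space N" for t
    using measurable_space[OF K that] by (auto simp: space_prob_algebra)
  \<comment> \<open>\<open>L t\<close> is the law of the pair with first component frozen at
    \<open>t\<close> and second component drawn from \<open>K t\<close>.\<close>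
  define L where "L t = K t \<bind> (\<lambda>y. return (N \<Otimes>\<^sub>M S) (t, y))" for t
  have L[measurable]: "L \<in> measurable N (prob_algebra (N \<Otimes>\<^sub>M S))" unfolding L_def by measurable
  have prob_T: "distr M N T \<in> space (prob_algebra N)"
    by (simp add: space_prob_algebra prob_space_distr)
  have L_nn: "(\<integral>\<^sup>+p. g p \<partial>L t) = (\<integral>\<^sup>+y. g (t, y) \<partial>K t)"
    if t: "t \<in> space N" and g[measurable]: "g \<in> borel_measurable (N \<Otimes>\<^sub>M S)" for t g
  proof -
    note KS(1)[OF t, measurable_cong]
    have "(\<integral>\<^sup>+p. g p \<partial>L t) = (\<integral>\<^sup>+y. (\<integral>\<^sup>+p. g p \<partial>return (N \<Otimes>\<^sub>M S) (t, y)) \<partial>K t)"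
      unfolding L_def using t by (intro nn_integral_bind[of _ "N \<Otimes>\<^sub>M S"]) measurable
    also have "\<dots> = (\<integral>\<^sup>+y. g (t, y) \<partial>K t)"
      using t sets_eq_imp_space_eq[OF KS(1)[OF t]]
      by (intro nn_integral_cong nn_integral_return) (auto simp: space_pair_measure)
    finally show ?thesis .
  qed
  let ?R = "{C \<times> A | C A. C \<in> sets N \<and> A \<in> G}"
  have "distr M (N \<Otimes>\<^sub>M S) (\<lambda>\<omega>. (T \<omega>, Y \<omega>)) = distr M N T \<bind> L"
  proof (rule measure_eqI_generator_eq[where E = ?R and \<Omega> = "space N \<times> space S" and A = "\<lambda>_. space N \<times> space S"])
    show "Int_stable ?R"
    proof (rule Int_stableI, clarify)
      fix C A C' A' assume "C \<in> sets N" "A \<in> G" "C' \<in> sets N" "A' \<in> G"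
      moreover have "(C \<times> A) \<inter> (C' \<times> A') = (C \<inter> C') \<times> (A \<inter> A')" by auto
      ultimately show "\<exists>C'' A''. C \<times> A \<inter> C' \<times> A' = C'' \<times> A'' \<and> C'' \<in> sets N \<and> A'' \<in> G"
        using G(1) by (metis Int_stableD sets.Int)
    qed
    show "?R \<subseteq> Pow (space N \<times> space S)" using G(2) sets.sets_into_space by fastforce
    have gen: "sets (N \<Otimes>\<^sub>M S) = sigma_sets (space N \<times> space S) ?R"
    proof -
      have "sets (N \<Otimes>\<^sub>M S) = sets (sigma (space N \<times> space S) {a \<times> b | a b. a \<in> sets N \<and> b \<in> G})"
        by (rule sets_pair_eq[where Ca = "{space N}" and Cb = "{space S}"])
          (use G S in \<open>auto simp: sets.sigma_sets_eq sets.space_closed\<close>)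
      also have "\<dots> = sigma_sets (space N \<times> space S) ?R"
        by (rule sets_measure_of) fact
      finally show ?thesis .
    qed
    then show "sets (distr M (N \<Otimes>\<^sub>M S) (\<lambda>\<omega>. (T \<omega>, Y \<omega>))) = sigma_sets (space N \<times> space S) ?R" by simp
    show "sets (distr M N T \<bind> L) = sigma_sets (space N \<times> space S) ?R"
    proof (subst sets_bind[where N = "N \<Otimes>\<^sub>M S"])
      obtain \<omega> where "\<omega> \<in> space M" using not_empty by auto
      from measurable_space[OF T' this] show "space (distr M N T) \<noteq> {}" by auto
      show "sets (L t) = sets (N \<Otimes>\<^sub>M S)" if "t \<in> space (distr M N T)" for t
        using measurable_space[OF L, of t] that by (simp add: space_prob_algebra)
    qed (rule gen)
    show "range (\<lambda>_. space N \<times> space S) \<subseteq> ?R" using G(3) by auto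
    show "(\<Union>i::nat. space N \<times> space S) = space N \<times> space S" by simp
    show "emeasure (distr M (N \<Otimes>\<^sub>M S) (\<lambda>\<omega>. (T \<omega>, Y \<omega>))) (space N \<times> space S) \<noteq> \<infinity>"
      by (subst emeasure_distr) (auto simp: space_pair_measure[symmetric])
    fix X assume "X \<in> ?R"
    then obtain C A where X: "X = C \<times> A" and C[measurable]: "C \<in> sets N" and A: "A \<in> G" by auto
    note [measurable] = GS[OF A]
    let ?I = "indicator (Y -` A \<inter> space M) :: 'a \<Rightarrow> real"
    have I[measurable]: "?I \<in> borel_measurable M" by measurable
    \<comment> \<open>The one place where measurability of \<open>T\<close> for the smaller algebra
      counts: on an event of \<open>F\<close> the indicator of \<open>Y\<close> in \<open>A\<close>
      may be replaced by its conditional expectation.\<close>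
    have CF: "T -` C \<inter> space M \<in> sets F"
      using measurable_sets[OF T C] F by (simp add: subalgebra_def)
    have iI: "integrable M ?I" by (rule integrable_real_indicator) (auto simp: emeasure_eq_measure)
    have m[measurable]: "(\<lambda>\<omega>. measure (K (T \<omega>)) A) \<in> borel_measurable M"
      by (rule measure_measurable_prob_algebra2[where N = S]) auto
    have "prob ((T -` C \<inter> space M) \<inter> (Y -` A \<inter> space M))
      = (\<integral>\<omega>. indicator (T -` C \<inter> space M) \<omega> * ?I \<omega> \<partial>M)"
      by (subst indicator_inter_arith[symmetric]) (simp add: Int_assoc)
    also have "\<dots> = (\<integral>\<omega>. indicator (T -` C \<inter> space M) \<omega> * real_cond_exp M F ?I \<omega> \<partial>M)"
      using F.real_cond_exp_intA[OF iI CF] by (simp add: set_lebesgue_integral_def)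
    also have "\<dots> = (\<integral>\<omega>. indicator (T -` C \<inter> space M) \<omega> * measure (K (T \<omega>)) A \<partial>M)"
      by (rule integral_cong_AE) (use cond[OF A] in auto)
    finally have eq: "ennreal (prob ((T -` C \<inter> space M) \<inter> (Y -` A \<inter> space M))) =
        ennreal (\<integral>\<omega>. indicator (T -` C \<inter> space M) \<omega> * measure (K (T \<omega>)) A \<partial>M)" by simp
    have "emeasure (distr M (N \<Otimes>\<^sub>M S) (\<lambda>\<omega>. (T \<omega>, Y \<omega>))) X
      = emeasure M ((T -` C \<inter> space M) \<inter> (Y -` A \<inter> space M))"
      unfolding X by (subst emeasure_distr) (auto intro!: arg_cong[where f = "emeasure M"])
    also have "\<dots> = ennreal (\<integral>\<omega>. indicator (T -` C \<inter> space M) \<omega> * measure (K (T \<omega>)) A \<partial>M)"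
      unfolding emeasure_eq_measure eq ..
    also have "\<dots> = (\<integral>\<^sup>+\<omega>. ennreal (indicator (T -` C \<inter> space M) \<omega> * measure (K (T \<omega>)) A) \<partial>M)"
    proof (rule nn_integral_eq_integral[symmetric])
      have "measure (K (T \<omega>)) A \<le> 1" if "\<omega> \<in> space M" for \<omega>
        using KS(2)[OF measurable_space[OF T' that]] by (rule prob_space.prob_le_1)
      then show "integrable M (\<lambda>\<omega>. indicator (T -` C \<inter> space M) \<omega> * measure (K (T \<omega>)) A)"
        by (intro integrable_const_bound[where B = 1]) (auto simp: indicator_def)
    qed auto
    also have "\<dots> = (\<integral>\<^sup>+\<omega>. emeasure (L (T \<omega>)) X \<partial>M)"
    proof (rule nn_integral_cong)
      fix \<omega> assume \<omega>: "\<omega> \<in> space M"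
      note t = measurable_space[OF T' \<omega>]
      interpret Kt: prob_space "K (T \<omega>)" by (rule KS(2)[OF t])
      have [simp]: "sets (L (T \<omega>)) = sets (N \<Otimes>\<^sub>M S)"
        using measurable_space[OF L t] by (simp add: space_prob_algebra)
      have "emeasure (L (T \<omega>)) X = (\<integral>\<^sup>+p. indicator X p \<partial>L (T \<omega>))"
        by (subst nn_integral_indicator) (auto simp: X)
      also have "\<dots> = (\<integral>\<^sup>+y. indicator C (T \<omega>) * indicator A y \<partial>K (T \<omega>))"
        by (subst L_nn[OF t]) (auto simp: X indicator_def intro!: nn_integral_cong)
      also have "\<dots> = indicator C (T \<omega>) * emeasure (K (T \<omega>)) A"
        using KS(1)[OF t] GS[OF A] by (simp add: nn_integral_cmult)
      finally show "ennreal (indicator (T -` C \<inter> space M) \<omega> * measure (K (T \<omega>)) A) = emeasure (L (T \<omega>)) X"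
        using \<omega> by (auto simp: indicator_def Kt.emeasure_eq_measure)
    qed
    also have "\<dots> = (\<integral>\<^sup>+t. emeasure (L t) X \<partial>distr M N T)"
      by (rule nn_integral_distr[symmetric])
        (auto simp: X intro!: emeasure_measurable_subprob_algebra2[OF _ measurable_prob_algebraD[OF L]])
    also have "\<dots> = emeasure (distr M N T \<bind> L) X"
      by (rule emeasure_bind_prob_algebra[OF prob_T L, symmetric]) (simp add: X)
    finally show "emeasure (distr M (N \<Otimes>\<^sub>M S) (\<lambda>\<omega>. (T \<omega>, Y \<omega>))) X = emeasure (distr M N T \<bind> L) X" .
  qed
  then have "(\<integral>\<^sup>+p. f p \<partial>distr M (N \<Otimes>\<^sub>M S) (\<lambda>\<omega>. (T \<omega>, Y \<omega>))) = (\<integral>\<^sup>+p. f p \<partial>(distr M N T \<bind> L))" by simp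
  moreover have "(\<integral>\<^sup>+p. f p \<partial>distr M (N \<Otimes>\<^sub>M S) (\<lambda>\<omega>. (T \<omega>, Y \<omega>))) = (\<integral>\<^sup>+\<omega>. f (T \<omega>, Y \<omega>) \<partial>M)"
    by (rule nn_integral_distr) auto
  moreover have "(\<integral>\<^sup>+p. f p \<partial>(distr M N T \<bind> L)) = (\<integral>\<^sup>+t. (\<integral>\<^sup>+p. f p \<partial>L t) \<partial>distr M N T)"
    by (rule nn_integral_bind[OF f]) (auto intro!: measurable_prob_algebraD simp: measurable_distr_eq1)
  moreover have "\<dots> = (\<integral>\<^sup>+\<omega>. (\<integral>\<^sup>+p. f p \<partial>L (T \<omega>)) \<partial>M)"
    by (rule nn_integral_distr) (auto intro!: nn_integral_measurable_subprob_algebra2[OF _ measurable_prob_algebraD[OF L]])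
  moreover have "\<dots> = (\<integral>\<^sup>+\<omega>. (\<integral>\<^sup>+y. f (T \<omega>, y) \<partial>K (T \<omega>)) \<partial>M)"
    by (intro nn_integral_cong L_nn f measurable_space[OF T'])
  ultimately show ?thesis by simp
qed


section \<open>Measurability of the score and of the Born kernel\<close>

text \<open>A directional derivative as a limit along a sequence; countable limits preserve
  measurability, which is how the score becomes measurable.\<close>

lemma GDERIV_difference_quotients:
  assumes "GDERIV f x :> D"
  shows "(\<lambda>m. (f (x + inverse (real (Suc m)) *\<^sub>R b) - f x) * real (Suc m)) \<longlonglongrightarrow> inner b D"
proof -
  have "((\<lambda>t. x + t *\<^sub>R b) has_derivative (\<lambda>s. s *\<^sub>R b)) (at 0)"
    by (auto intro!: derivative_eq_intros)
  moreover have "(f has_derivative (\<lambda>h. inner h D)) (at (x + 0 *\<^sub>R b))"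
    using assms by (simp add: gderiv_def)
  ultimately have "((\<lambda>t. f (x + t *\<^sub>R b)) has_derivative (\<lambda>s. inner (s *\<^sub>R b) D)) (at 0)"
    by (rule has_derivative_compose)
  then have "((\<lambda>t. f (x + t *\<^sub>R b)) has_real_derivative inner b D) (at 0)"
    by (rule has_derivative_imp_has_field_derivative) simp
  then have lim: "((\<lambda>t. (f (x + t *\<^sub>R b) - f x) / t) \<longlongrightarrow> inner b D) (at 0)"
    by (simp add: DERIV_def)
  have "filterlim (\<lambda>m. inverse (real (Suc m))) (at 0) sequentially"
    using LIMSEQ_inverse_real_of_nat by (auto simp: filterlim_at)
  from filterlim_compose[OF lim this] show ?thesis by (simp add: divide_inverse)
qed

text \<open>Writing \<open>ln \<bar>y\<bar>\<close> as half of \<open>ln (y\<^sup>2)\<close> removes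
  the absolute value and with it a case split on the sign.\<close>

lemma ln_abs_differentiable:
  fixes f :: "'a::real_normed_vector \<Rightarrow> real"
  assumes "f differentiable (at x)" "f x \<noteq> 0"
  shows "(\<lambda>t. ln \<bar>f t\<bar>) differentiable (at x)"
proof -
  have eq: "ln \<bar>y\<bar> = ln (y\<^sup>2) / 2" for y :: real
  proof (cases "y = 0")
    case False
    then have "ln (\<bar>y\<bar> ^ 2) = 2 * ln \<bar>y\<bar>" by (subst ln_realpow) auto
    then show ?thesis by (simp only: power2_abs)
  qed simp
  have "0 < (f x)\<^sup>2" using assms(2) by simp
  from DERIV_cdivide[OF DERIV_chain2[OF DERIV_ln[OF this] DERIV_pow], of 2]
  have "((\<lambda>y. ln (y\<^sup>2) / 2) has_real_derivative inverse ((f x)\<^sup>2) * (real 2 * f x ^ (2 - Suc 0)) / 2) (at (f x))" .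
  then have "(\<lambda>y. ln (y\<^sup>2) / 2) differentiable (at (f x))"
    unfolding has_field_derivative_def differentiable_def by blast
  from differentiable_chain_at[OF assms(1) this] show ?thesis unfolding eq by (simp only: comp_def)
qed

section \<open>Vector-valued integrals by coordinates, and auxiliary measurability facts\<close>

lemma integrable_vec:
  fixes f :: "'a \<Rightarrow> real ^ 'n"
  assumes "\<And>j. integrable M (\<lambda>x. f x $ j)"
  shows "integrable M f"
proof -
  have "integrable M (\<lambda>x. \<Sum>j\<in>UNIV. (f x $ j) *\<^sub>R axis j (1::real))"
    using assms by (intro Bochner_Integration.integrable_sum integrable_scaleR_left)
  moreover have "(\<Sum>j\<in>UNIV. (f x $ j) *\<^sub>R axis j 1) = f x" for x
    using basis_expansion[of "f x"] by (simp only: scalar_mult_eq_scaleR)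
  ultimately show ?thesis by simp
qed

lemma integral_vec_nth:
  fixes f :: "'a \<Rightarrow> real ^ 'n"
  assumes "integrable M f"
  shows "(\<integral>x. f x \<partial>M) $ j = (\<integral>x. f x $ j \<partial>M)"
  using integral_bounded_linear[OF bounded_linear_vec_nth assms, of j] by simp

lemma borel_measurable_vec_iff:
  fixes f :: "'a \<Rightarrow> real ^ 'n"
  shows "f \<in> borel_measurable M \<longleftrightarrow> (\<forall>j. (\<lambda>x. f x $ j) \<in> borel_measurable M)"
  by (auto simp: borel_measurable_euclidean_space[of f] Basis_vec_def inner_axis)

lemma borel_measurable_vec_nth [measurable (raw)]:
  fixes f :: "'a \<Rightarrow> real ^ 'n"
  assumes "f \<in> borel_measurable M"
  shows "(\<lambda>x. f x $ j) \<in> borel_measurable M"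
  using assms by (simp add: borel_measurable_vec_iff)

lemma norm_vec_power2: "(norm v)\<^sup>2 = (\<Sum>j\<in>UNIV. (v $ j)\<^sup>2)" for v :: "real ^ 'n"
  unfolding power2_norm_eq_inner by (simp add: inner_vec_def power2_eq_square)

lemma det_measurable:
  fixes B :: "'z \<Rightarrow> real ^ 'n ^ 'n"
  assumes "\<And>i j. (\<lambda>z. B z $ i $ j) \<in> borel_measurable A"
  shows "(\<lambda>z. det (B z)) \<in> borel_measurable A"
  unfolding det_def
  by (intro borel_measurable_sum borel_measurable_times borel_measurable_prod borel_measurable_const assms)

text \<open>Integrability has to be derived along with the bound, since the real integral of a
  nonintegrable function is 0 by convention and a bound for it would say nothing.\<close>

lemma nonneg_integral_le_of_nn_integral:
  fixes f :: "'a \<Rightarrow> real"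
  assumes "f \<in> borel_measurable M" "\<And>x. 0 \<le> f x" "(\<integral>\<^sup>+x. ennreal (f x) \<partial>M) \<le> ennreal B" "0 \<le> B"
  shows "integrable M f" "(\<integral>x. f x \<partial>M) \<le> B"
proof -
  show "integrable M f"
    using assms by (intro integrableI_nonneg) (auto intro: le_less_trans[OF _ ennreal_less_top])
  show "(\<integral>x. f x \<partial>M) \<le> B"
    using assms by (subst integral_eq_nn_integral) (auto intro: enn2real_leI)
qed

lemma measurable_eq_on_space:
  assumes "g \<in> measurable M N" "\<And>x. x \<in> space M \<Longrightarrow> f x = g x"
  shows "f \<in> measurable M N"
  using assms measurable_cong[of M f g N] by simp

section \<open>The filtration generated by the batches\<close>

lemma past_batches_space [simp]: "space (past_batches P M n X k) = space P"
  unfolding past_batches_def by (rule space_measure_of) auto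

lemma past_batches_sets:
  "sets (past_batches P M n X k) =
    sigma_sets (space P) {X j i -` A \<inter> space P | j i A. j < k \<and> i < n \<and> A \<in> sets M}"
  unfolding past_batches_def by (rule sets_measure_of) auto

lemma past_batches_mono:
  assumes "k \<le> l"
  shows "subalgebra (past_batches P M n X l) (past_batches P M n X k)"
proof -
  have "{X j i -` A \<inter> space P | j i A. j < k \<and> i < n \<and> A \<in> sets M}
      \<subseteq> {X j i -` A \<inter> space P | j i A. j < l \<and> i < n \<and> A \<in> sets M}"
    using order_less_le_trans[OF _ assms] by blast
  then show ?thesis
    unfolding subalgebra_def past_batches_sets past_batches_space by (auto intro: sigma_sets_mono'[THEN subsetD])
qed

lemma subalgebra_past_batches:
  assumes "\<And>k i. i < n \<Longrightarrow> X k i \<in> measurable P M"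
  shows "subalgebra P (past_batches P M n X k)"
  unfolding subalgebra_def past_batches_sets
  using assms by (auto intro!: sets.sigma_sets_subset measurable_sets)

lemma past_batches_measurable:
  assumes "X j i \<in> measurable P M" "j < k" "i < n"
  shows "X j i \<in> measurable (past_batches P M n X k) M"
proof (rule measurableI)
  fix A assume "A \<in> sets M"
  with assms show "X j i -` A \<inter> space (past_batches P M n X k) \<in> sets (past_batches P M n X k)"
    unfolding past_batches_sets by (auto intro!: sigma_sets.Basic)
qed (use measurable_space[OF assms(1)] in simp)

text \<open>The setting over a general configuration space. Joint measurability in parameter and
  configuration is demanded because samples are evaluated at random parameters; sigma-finiteness
  makes integrals over \<open>M\<close> measurable in the parameter.\<close>

locale vmc =
  fixes M :: "'c measure" and H :: "('c \<Rightarrow> real) \<Rightarrow> 'c \<Rightarrow> real" and \<psi> :: "real ^ 'p \<Rightarrow> 'c \<Rightarrow> real"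
    and C\<^sub>m :: real
  assumes sigma_finite: "sigma_finite_measure M"
    and \<psi>_L2: "\<And>\<theta>. \<psi> \<theta> \<in> L2 M"
    and \<psi>_nonzero: "\<And>\<theta>. \<not> (AE x in M. \<psi> \<theta> x = 0)"
    and \<psi>_measurable: "(\<lambda>(\<theta>, x). \<psi> \<theta> x) \<in> borel_measurable (borel \<Otimes>\<^sub>M M)"
    and H\<psi>_measurable: "(\<lambda>(\<theta>, x). H (\<psi> \<theta>) x) \<in> borel_measurable (borel \<Otimes>\<^sub>M M)"
    and \<psi>_differentiable:
      "\<And>\<theta> x. x \<in> space M \<Longrightarrow> \<psi> \<theta> x \<noteq> 0 \<Longrightarrow> (\<lambda>t. \<psi> t x) differentiable (at \<theta>)"
    and vmc_identity: "\<And>\<theta>. energy_grad M H \<psi> \<theta> =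
      2 *\<^sub>R (\<integral>x. centered_energy M H \<psi> \<theta> x *\<^sub>R centered_score M \<psi> \<theta> x \<partial>born M \<psi> \<theta>)"
    and score_moment:
      "\<And>\<theta>. integrable (born M \<psi> \<theta>) (\<lambda>x. norm (score \<psi> \<theta> x) ^ 4)"
      "\<And>\<theta>. (\<integral>x. norm (score \<psi> \<theta> x) ^ 4 \<partial>born M \<psi> \<theta>) \<le> C\<^sub>m"
    and energy_moment:
      "\<And>\<theta>. integrable (born M \<psi> \<theta>) (\<lambda>x. local_energy H \<psi> \<theta> x ^ 4)"
      "\<And>\<theta>. (\<integral>x. local_energy H \<psi> \<theta> x ^ 4 \<partial>born M \<psi> \<theta>) \<le> C\<^sub>m"
begin

lemma \<psi>_comp [measurable (raw)]:
  assumes [measurable]: "T \<in> borel_measurable A" "Y \<in> measurable A M"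
  shows "(\<lambda>z. \<psi> (T z) (Y z)) \<in> borel_measurable A"
  using measurable_compose[OF _ \<psi>_measurable, of "\<lambda>z. (T z, Y z)" A] by simp

lemma H\<psi>_comp [measurable (raw)]:
  assumes [measurable]: "T \<in> borel_measurable A" "Y \<in> measurable A M"
  shows "(\<lambda>z. H (\<psi> (T z)) (Y z)) \<in> borel_measurable A"
  using measurable_compose[OF _ H\<psi>_measurable, of "\<lambda>z. (T z, Y z)" A] by simp

lemma local_energy_comp [measurable (raw)]:
  assumes [measurable]: "T \<in> borel_measurable A" "Y \<in> measurable A M"
  shows "(\<lambda>z. local_energy H \<psi> (T z) (Y z)) \<in> borel_measurable A"
  unfolding local_energy_def by measurable

text \<open>Each component of the score is a pointwise limit of difference quotients, which are
  jointly measurable.\<close>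

lemma score_comp [measurable (raw)]:
  assumes [measurable]: "T \<in> borel_measurable A" "Y \<in> measurable A M"
  shows "(\<lambda>z. score \<psi> (T z) (Y z)) \<in> borel_measurable A"
proof -
  have "(\<lambda>z. score \<psi> (T z) (Y z) \<bullet> b) \<in> borel_measurable A" for b
  proof -
    \<comment> \<open>The quotient is set to 0 on the nodal set, matching the default value of
      \<open>score\<close> there.\<close>
    let ?q = "\<lambda>m z. if \<psi> (T z) (Y z) = 0 then 0 else
      (ln \<bar>\<psi> (T z + inverse (real (Suc m)) *\<^sub>R b) (Y z)\<bar> - ln \<bar>\<psi> (T z) (Y z)\<bar>) * real (Suc m)"
    have "(\<lambda>z. lim (\<lambda>m. ?q m z)) \<in> borel_measurable A" by measurable
    moreover have "lim (\<lambda>m. ?q m z) = score \<psi> (T z) (Y z) \<bullet> b" if "z \<in> space A" for z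
    proof (rule limI, cases "\<psi> (T z) (Y z) = 0")
      case False
      have "GDERIV (\<lambda>t. ln \<bar>\<psi> t (Y z)\<bar>) (T z) :> score \<psi> (T z) (Y z)"
        using False ln_abs_differentiable[OF \<psi>_differentiable[OF _ False]]
          measurable_space[OF assms(2) that] by (simp add: score_def GDERIV_grad)
      from GDERIV_difference_quotients[OF this, of b] False
      show "(\<lambda>m. ?q m z) \<longlonglongrightarrow> score \<psi> (T z) (Y z) \<bullet> b" by (simp add: inner_commute)
    qed (simp add: score_def)
    ultimately show ?thesis by (simp cong: measurable_cong)
  qed
  then show ?thesis by (subst borel_measurable_euclidean_space) blast
qed

section \<open>The Born law, the energy and its gradient as expectations\<close>

definition normalization :: "real ^ 'p \<Rightarrow> real" where
  "normalization \<theta> = (\<integral>y. \<bar>\<psi> \<theta> y\<bar>\<^sup>2 \<partial>M)"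

lemma \<psi>_square: "\<psi> \<theta> \<in> borel_measurable M" "integrable M (\<lambda>x. (\<psi> \<theta> x)\<^sup>2)"
  using \<psi>_L2[of \<theta>] by (auto simp: L2_def)

lemma normalization_pos: "normalization \<theta> > 0"
proof -
  have "normalization \<theta> \<noteq> 0"
    using \<psi>_nonzero[of \<theta>] \<psi>_square[of \<theta>] unfolding normalization_def
    by (subst integral_nonneg_eq_0_iff_AE) auto
  moreover have "normalization \<theta> \<ge> 0" unfolding normalization_def by simp
  ultimately show ?thesis by simp
qed

lemma born_eq: "born M \<psi> \<theta> = density M (\<lambda>x. ennreal ((\<psi> \<theta> x)\<^sup>2 / normalization \<theta>))"
  by (simp add: born_def normalization_def)

lemma sets_born [simp, measurable_cong]: "sets (born M \<psi> \<theta>) = sets M"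
  by (simp add: born_eq)

lemma space_born [simp]: "space (born M \<psi> \<theta>) = space M"
  by (simp add: born_eq)

lemma prob_space_born: "prob_space (born M \<psi> \<theta>)"
proof
  note [measurable] = \<psi>_square(1)
  have "emeasure (born M \<psi> \<theta>) (space (born M \<psi> \<theta>)) = (\<integral>\<^sup>+x. ennreal ((\<psi> \<theta> x)\<^sup>2 / normalization \<theta>) \<partial>M)"
    by (simp add: born_eq emeasure_density cong: nn_integral_cong)
  also have "\<dots> = ennreal (\<integral>x. (\<psi> \<theta> x)\<^sup>2 / normalization \<theta> \<partial>M)"
    using \<psi>_square(2)[of \<theta>] normalization_pos[of \<theta>] by (intro nn_integral_eq_integral) auto
  also have "\<dots> = 1"
    using normalization_pos[of \<theta>] by (simp add: normalization_def)
  finally show "emeasure (born M \<psi> \<theta>) (space (born M \<psi> \<theta>)) = 1" .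
qed

lemma normalization_measurable [measurable]: "normalization \<in> borel_measurable borel"
proof -
  interpret sigma_finite_measure M by (rule sigma_finite)
  have [measurable]: "(\<lambda>(\<theta>, x). \<bar>\<psi> \<theta> x\<bar>\<^sup>2) \<in> borel_measurable (borel \<Otimes>\<^sub>M M)" by measurable
  show ?thesis unfolding normalization_def[abs_def] by measurable
qed

lemma emeasure_born_measurable:
  assumes [measurable]: "A \<in> sets M"
  shows "(\<lambda>\<theta>. emeasure (born M \<psi> \<theta>) A) \<in> borel_measurable borel"
proof -
  interpret sigma_finite_measure M by (rule sigma_finite)
  have "emeasure (born M \<psi> \<theta>) A = (\<integral>\<^sup>+x. ennreal ((\<psi> \<theta> x)\<^sup>2 / normalization \<theta>) * indicator A x \<partial>M)" for \<theta>
    unfolding born_eq using \<psi>_square(1)[of \<theta>] by (intro emeasure_density) auto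
  then show ?thesis by simp
qed

text \<open>A coordinate is at most the norm in absolute value; this allows the scalar covariance
  estimates to be applied to each coordinate of the score.\<close>

lemma score_coordinate_moment:
  "integrable (born M \<psi> \<theta>) (\<lambda>x. (score \<psi> \<theta> x $ j) ^ 4)"
  "(\<integral>x. (score \<psi> \<theta> x $ j) ^ 4 \<partial>born M \<psi> \<theta>) \<le> C\<^sub>m"
proof -
  have le: "(v $ j) ^ 4 \<le> norm v ^ 4" for v :: "real ^ 'p"
  proof -
    have "(v $ j) ^ 4 = \<bar>v $ j\<bar> ^ 4" by simp
    also have "\<dots> \<le> norm v ^ 4" by (intro power_mono component_le_norm_cart) simp
    finally show ?thesis .
  qed
  show i: "integrable (born M \<psi> \<theta>) (\<lambda>x. (score \<psi> \<theta> x $ j) ^ 4)"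
    by (rule Bochner_Integration.integrable_bound[OF score_moment(1)[of \<theta>]]) (use le in auto)
  show "(\<integral>x. (score \<psi> \<theta> x $ j) ^ 4 \<partial>born M \<psi> \<theta>) \<le> C\<^sub>m"
    using order_trans[OF integral_mono[OF i score_moment(1) le] score_moment(2)] .
qed

lemma local_energy_measurable: "local_energy H \<psi> \<theta> \<in> borel_measurable (born M \<psi> \<theta>)"
  by measurable

lemma score_coordinate_measurable: "(\<lambda>x. score \<psi> \<theta> x $ j) \<in> borel_measurable (born M \<psi> \<theta>)"
  by measurable

text \<open>One factor of the squared wavefunction cancels the denominator of the local energy; on
  the nodal set both integrands are 0, because \<open>a / 0 = 0\<close>.\<close>

lemma energy_eq: "energy M H \<psi> \<theta> = (\<integral>x. local_energy H \<psi> \<theta> x \<partial>born M \<psi> \<theta>)"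
proof -
  note [measurable] = \<psi>_square(1)
  have "(\<integral>x. local_energy H \<psi> \<theta> x \<partial>born M \<psi> \<theta>)
    = (\<integral>x. (\<psi> \<theta> x)\<^sup>2 / normalization \<theta> * local_energy H \<psi> \<theta> x \<partial>M)"
    unfolding born_eq using normalization_pos[of \<theta>] by (subst integral_density) auto
  also have "\<dots> = (\<integral>x. \<psi> \<theta> x * H (\<psi> \<theta>) x / normalization \<theta> \<partial>M)"
    by (rule Bochner_Integration.integral_cong) (auto simp: local_energy_def power2_eq_square)
  also have "\<dots> = energy M H \<psi> \<theta>"
    by (simp add: energy_def L2_inner_def normalization_def power2_eq_square)
  finally show ?thesis ..
qed

text \<open>The energy is the mean of a variable with bounded fourth moment. This provides the
  two-sided bound \<open>B\<close> of the Lyapunov argument.\<close>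

lemma energy_bounded: "\<bar>energy M H \<psi> \<theta>\<bar> \<le> 1 + C\<^sub>m"
  unfolding energy_eq
  by (rule prob_space.expectation_lower_powers_le(1)[OF prob_space_born local_energy_measurable energy_moment])

text \<open>Means are written as integrals of the local energy and of one score coordinate, so that
  the expression is literally the target covariance in
  \<open>sample_covariance_error\<close>.\<close>

abbreviation covariance :: "real ^ 'p \<Rightarrow> 'p \<Rightarrow> real" where
  "covariance \<theta> j \<equiv> (\<integral>x. (local_energy H \<psi> \<theta> x - (\<integral>x. local_energy H \<psi> \<theta> x \<partial>born M \<psi> \<theta>)) *
      (score \<psi> \<theta> x $ j - (\<integral>x. score \<psi> \<theta> x $ j \<partial>born M \<psi> \<theta>)) \<partial>born M \<psi> \<theta>)"

text \<open>The VMC identity read coordinate by coordinate. Taking a coordinate under the integral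
  requires integrability, both of the score and of its product with the centred energy.\<close>

lemma energy_grad_nth: "energy_grad M H \<psi> \<theta> $ j = 2 * covariance \<theta> j"
proof -
  interpret prob_space "born M \<psi> \<theta>" by (rule prob_space_born)
  have "integrable (born M \<psi> \<theta>) (score \<psi> \<theta>)"
    using integrable_lower_powers(1)[OF score_coordinate_measurable score_coordinate_moment(1)]
    by (rule integrable_vec)
  then have s: "centered_score M \<psi> \<theta> x $ j = score \<psi> \<theta> x $ j - (\<integral>x. score \<psi> \<theta> x $ j \<partial>born M \<psi> \<theta>)" for x j
    by (simp add: centered_score_def integral_vec_nth)
  have "integrable (born M \<psi> \<theta>) (\<lambda>x. centered_energy M H \<psi> \<theta> x *\<^sub>R centered_score M \<psi> \<theta> x)"
    using covariance_bounded(1)[OF local_energy_measurable score_coordinate_measurable energy_moment score_coordinate_moment]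
    by (intro integrable_vec) (simp add: s centered_energy_def energy_eq)
  then show ?thesis
    by (simp add: vmc_identity integral_vec_nth s centered_energy_def energy_eq)
qed

text \<open>The bound itself does not enter the final constants; it ensures that the squared
  gradient at a random iterate is integrable.\<close>

lemma energy_grad_bounded:
  "(norm (energy_grad M H \<psi> \<theta>))\<^sup>2 \<le> CARD('p) * (2 * (1 + centered_moment_bound C\<^sub>m))\<^sup>2"
proof -
  interpret prob_space "born M \<psi> \<theta>" by (rule prob_space_born)
  have cov: "\<bar>covariance \<theta> j\<bar> \<le> 1 + centered_moment_bound C\<^sub>m" for j
    by (rule covariance_bounded(2)[OF local_energy_measurable score_coordinate_measurable energy_moment score_coordinate_moment])
  have "\<bar>energy_grad M H \<psi> \<theta> $ j\<bar> \<le> 2 * (1 + centered_moment_bound C\<^sub>m)" for j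
    unfolding energy_grad_nth abs_mult using cov[of j] by simp
  then have "\<bar>energy_grad M H \<psi> \<theta> $ j\<bar>\<^sup>2 \<le> (2 * (1 + centered_moment_bound C\<^sub>m))\<^sup>2" for j
    by (intro power_mono) auto
  then have "(energy_grad M H \<psi> \<theta> $ j)\<^sup>2 \<le> (2 * (1 + centered_moment_bound C\<^sub>m))\<^sup>2" for j
    by (simp only: power2_abs)
  then show ?thesis unfolding norm_vec_power2
    using sum_bounded_above[of UNIV "\<lambda>j. (energy_grad M H \<psi> \<theta> $ j)\<^sup>2"] by simp
qed


section \<open>Accuracy of the estimators\<close>

definition gradient_error_bound :: real where
  "gradient_error_bound = CARD('p) * (4 * covariance_error_bound C\<^sub>m)"

abbreviation batch_law :: "nat \<Rightarrow> real ^ 'p \<Rightarrow> (nat \<Rightarrow> 'c) measure" where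
  "batch_law n \<theta> \<equiv> PiM {..<n} (\<lambda>_. born M \<psi> \<theta>)"

lemma batch_grad_nth:
  "batch_grad H \<psi> n \<theta> b $ j = 2 * ((\<Sum>i<n.
      (local_energy H \<psi> \<theta> (b i) - (\<Sum>l<n. local_energy H \<psi> \<theta> (b l)) / n) *
      (score \<psi> \<theta> (b i) $ j - (\<Sum>l<n. score \<psi> \<theta> (b l) $ j) / n)) / (real n - 1))"
  by (simp add: batch_grad_def batch_centered_energy_def batch_energy_def batch_centered_score_def)

text \<open>Each coordinate of the error is twice a sample covariance error, so its square
  contributes a factor 4, and the \<open>CARD('p)\<close> coordinates are added up.\<close>

lemma batch_grad_error:
  assumes n: "n \<ge> 2"
  shows "integrable (batch_law n \<theta>) (\<lambda>b. (norm (batch_grad H \<psi> n \<theta> b - energy_grad M H \<psi> \<theta>))\<^sup>2)"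
    and "(\<integral>b. (norm (batch_grad H \<psi> n \<theta> b - energy_grad M H \<psi> \<theta>))\<^sup>2 \<partial>batch_law n \<theta>)
      \<le> gradient_error_bound / n"
proof -
  interpret prob_space "born M \<psi> \<theta>" by (rule prob_space_born)
  define err where "err j b = (\<Sum>i<n.
      (local_energy H \<psi> \<theta> (b i) - (\<Sum>l<n. local_energy H \<psi> \<theta> (b l)) / n) *
      (score \<psi> \<theta> (b i) $ j - (\<Sum>l<n. score \<psi> \<theta> (b l) $ j) / n)) / (real n - 1) - covariance \<theta> j" for j b
  have err: "integrable (batch_law n \<theta>) (\<lambda>b. (err j b)\<^sup>2)"
    "(\<integral>b. (err j b)\<^sup>2 \<partial>batch_law n \<theta>) \<le> covariance_error_bound C\<^sub>m / n" for j
    unfolding err_def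
    by (rule sample_covariance_error[OF n local_energy_measurable score_coordinate_measurable
          energy_moment score_coordinate_moment])+
  have eq: "(norm (batch_grad H \<psi> n \<theta> b - energy_grad M H \<psi> \<theta>))\<^sup>2 = (\<Sum>j\<in>UNIV. 4 * (err j b)\<^sup>2)" for b
  proof -
    have "(batch_grad H \<psi> n \<theta> b - energy_grad M H \<psi> \<theta>) $ j = 2 * err j b" for j
      unfolding vector_minus_component batch_grad_nth energy_grad_nth err_def right_diff_distrib ..
    then show ?thesis by (simp add: norm_vec_power2 power_mult_distrib)
  qed
  show "integrable (batch_law n \<theta>) (\<lambda>b. (norm (batch_grad H \<psi> n \<theta> b - energy_grad M H \<psi> \<theta>))\<^sup>2)"
    unfolding eq using err(1) by simp
  have "(\<integral>b. (\<Sum>j\<in>UNIV. 4 * (err j b)\<^sup>2) \<partial>batch_law n \<theta>) = (\<Sum>j\<in>UNIV. 4 * (\<integral>b. (err j b)\<^sup>2 \<partial>batch_law n \<theta>))"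
    using err(1) by (subst Bochner_Integration.integral_sum) auto
  also have "\<dots> \<le> (\<Sum>j\<in>(UNIV :: 'p set). 4 * (covariance_error_bound C\<^sub>m / n))"
    by (intro sum_mono mult_left_mono err(2)) simp
  also have "\<dots> = gradient_error_bound / n" by (simp add: gradient_error_bound_def)
  finally show "(\<integral>b. (norm (batch_grad H \<psi> n \<theta> b - energy_grad M H \<psi> \<theta>))\<^sup>2 \<partial>batch_law n \<theta>)
      \<le> gradient_error_bound / n" unfolding eq .
qed

text \<open>Centring at the sample mean only lowers the sum of squares; then Cauchy-Schwarz, and
  \<open>n - 1 \<ge> n / 2\<close>.\<close>

lemma inner_batch_S_le:
  assumes n: "n \<ge> 2"
  shows "inner v (batch_S \<psi> n \<theta> b *v v) \<le> (norm v)\<^sup>2 * (2 / n * (\<Sum>i<n. (norm (score \<psi> \<theta> (b i)))\<^sup>2))"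
proof -
  define y where "y i = inner (score \<psi> \<theta> (b i)) v" for i
  have o: "inner (batch_centered_score \<psi> n \<theta> b i) v = y i - (\<Sum>l<n. y l) / n" for i
    by (simp add: batch_centered_score_def y_def inner_diff_left inner_sum_left)
  have "(\<Sum>i<n. (y i - (\<Sum>l<n. y l) / n) * (y i - (\<Sum>l<n. y l) / n)) = (\<Sum>i<n. y i * y i) - (\<Sum>i<n. y i) * (\<Sum>i<n. y i) / n"
    using n by (intro sum_centered_products) simp
  also have "\<dots> \<le> (\<Sum>i<n. y i * y i)" by simp
  also have "\<dots> \<le> (\<Sum>i<n. (norm v)\<^sup>2 * (norm (score \<psi> \<theta> (b i)))\<^sup>2)"
  proof (rule sum_mono)
    fix i
    have "\<bar>y i\<bar>\<^sup>2 \<le> (norm (score \<psi> \<theta> (b i)) * norm v)\<^sup>2"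
      unfolding y_def by (intro power_mono Cauchy_Schwarz_ineq2) simp
    then show "y i * y i \<le> (norm v)\<^sup>2 * (norm (score \<psi> \<theta> (b i)))\<^sup>2"
      by (simp add: power2_eq_square[of "y i"] power_mult_distrib mult.commute)
  qed
  finally have *: "(\<Sum>i<n. (y i - (\<Sum>l<n. y l) / n) * (y i - (\<Sum>l<n. y l) / n))
      \<le> (norm v)\<^sup>2 * (\<Sum>i<n. (norm (score \<psi> \<theta> (b i)))\<^sup>2)" by (simp add: sum_distrib_left)
  have "inner v (batch_S \<psi> n \<theta> b *v v) \<le> (norm v)\<^sup>2 * (\<Sum>i<n. (norm (score \<psi> \<theta> (b i)))\<^sup>2) / (real n / 2)"
    unfolding inner_batch_S o by (rule frac_le[OF _ *]) (use n in \<open>auto simp: sum_nonneg\<close>)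
  then show ?thesis by (simp add: mult_ac)
qed

text \<open>Here \<open>v\<close> is deterministic. It becomes the gradient at the current iterate
  once the past is frozen.\<close>

lemma nn_integral_inner_batch_S:
  assumes n: "n \<ge> 2"
  shows "(\<integral>\<^sup>+b. ennreal (inner v (batch_S \<psi> n \<theta> b *v v)) \<partial>batch_law n \<theta>)
    \<le> ennreal (2 * (1 + C\<^sub>m) * (norm v)\<^sup>2)"
proof -
  interpret prob_space "born M \<psi> \<theta>" by (rule prob_space_born)
  have [measurable]: "score \<psi> \<theta> \<in> borel_measurable (born M \<psi> \<theta>)" by measurable
  have s: "integrable (born M \<psi> \<theta>) (\<lambda>x. (norm (score \<psi> \<theta> x))\<^sup>2)"
    "expectation (\<lambda>x. (norm (score \<psi> \<theta> x))\<^sup>2) \<le> 1 + C\<^sub>m"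
    using integrable_lower_powers(2)[OF _ score_moment(1)] expectation_lower_powers_le(2)[OF _ score_moment] by auto
  have i: "integrable (batch_law n \<theta>) (\<lambda>b. (norm (score \<psi> \<theta> (b i)))\<^sup>2)"
    "(\<integral>b. (norm (score \<psi> \<theta> (b i)))\<^sup>2 \<partial>batch_law n \<theta>) \<le> 1 + C\<^sub>m" if "i < n" for i
    using integrable_PiM_component[of i "{..<n}" "\<lambda>x. (norm (score \<psi> \<theta> x))\<^sup>2"]
      integral_PiM_component[of i "{..<n}" "\<lambda>x. (norm (score \<psi> \<theta> x))\<^sup>2"] s that by auto
  have int: "integrable (batch_law n \<theta>) (\<lambda>b. (norm v)\<^sup>2 * (2 / n * (\<Sum>i<n. (norm (score \<psi> \<theta> (b i)))\<^sup>2)))"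
    using i by (intro integrable_mult_right Bochner_Integration.integrable_sum) auto
  have "(\<integral>\<^sup>+b. ennreal (inner v (batch_S \<psi> n \<theta> b *v v)) \<partial>batch_law n \<theta>)
    \<le> (\<integral>\<^sup>+b. ennreal ((norm v)\<^sup>2 * (2 / n * (\<Sum>i<n. (norm (score \<psi> \<theta> (b i)))\<^sup>2))) \<partial>batch_law n \<theta>)"
    by (intro nn_integral_mono ennreal_leI inner_batch_S_le n)
  also have "\<dots> = ennreal (\<integral>b. (norm v)\<^sup>2 * (2 / n * (\<Sum>i<n. (norm (score \<psi> \<theta> (b i)))\<^sup>2)) \<partial>batch_law n \<theta>)"
    by (rule nn_integral_eq_integral[OF int]) (simp add: sum_nonneg)
  also have "(\<integral>b. (norm v)\<^sup>2 * (2 / n * (\<Sum>i<n. (norm (score \<psi> \<theta> (b i)))\<^sup>2)) \<partial>batch_law n \<theta>)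
    = (norm v)\<^sup>2 * (2 / n * (\<Sum>i<n. \<integral>b. (norm (score \<psi> \<theta> (b i)))\<^sup>2 \<partial>batch_law n \<theta>))"
    using i by (simp add: Bochner_Integration.integral_sum)
  also have "\<dots> \<le> (norm v)\<^sup>2 * (2 / n * (\<Sum>i<n. 1 + C\<^sub>m))"
    using i by (intro mult_left_mono sum_mono) auto
  also have "\<dots> = 2 * (1 + C\<^sub>m) * (norm v)\<^sup>2" using n by simp
  finally show ?thesis by (simp add: ennreal_leI)
qed


section \<open>Measurability of the iterates\<close>

lemma batch_centered_score_comp:
  assumes [measurable]: "T \<in> borel_measurable A" and b: "\<And>i. i < n \<Longrightarrow> (\<lambda>z. b z i) \<in> measurable A M" and "i < n"
  shows "(\<lambda>z. batch_centered_score \<psi> n (T z) (b z) i) \<in> borel_measurable A"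
  unfolding batch_centered_score_def using assms
  by (intro borel_measurable_diff borel_measurable_scaleR borel_measurable_sum borel_measurable_const score_comp) auto

lemma batch_grad_comp:
  assumes [measurable]: "T \<in> borel_measurable A" and b: "\<And>i. i < n \<Longrightarrow> (\<lambda>z. b z i) \<in> measurable A M"
  shows "(\<lambda>z. batch_grad H \<psi> n (T z) (b z)) \<in> borel_measurable A"
  unfolding batch_grad_def batch_centered_energy_def batch_energy_def using assms
  by (intro borel_measurable_scaleR borel_measurable_sum borel_measurable_const borel_measurable_diff
      borel_measurable_times batch_centered_score_comp local_energy_comp) auto

lemma batch_S_comp:
  assumes [measurable]: "T \<in> borel_measurable A" and b: "\<And>i. i < n \<Longrightarrow> (\<lambda>z. b z i) \<in> measurable A M"
  shows "(\<lambda>z. batch_S \<psi> n (T z) (b z) $ i $ j) \<in> borel_measurable A"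
proof -
  have eq: "batch_S \<psi> n (T z) (b z) $ i $ j = 1 / (real n - 1) *
    (\<Sum>l<n. batch_centered_score \<psi> n (T z) (b z) l $ i * batch_centered_score \<psi> n (T z) (b z) l $ j)" for z
    by (simp add: batch_S_def outer_def)
  show ?thesis unfolding eq using assms
    by (intro borel_measurable_sum borel_measurable_times borel_measurable_const
        borel_measurable_vec_nth batch_centered_score_comp) auto
qed

lemma increment_comp:
  assumes T: "T \<in> borel_measurable A" and w: "w \<in> borel_measurable A"
    and b: "\<And>i. i < n \<Longrightarrow> (\<lambda>z. b z i) \<in> measurable A M" and "lam > 0" "n \<ge> 1"
  shows "(\<lambda>z. matrix_inv (lam *\<^sub>R mat 1 + batch_S \<psi> n (T z) (b z)) *v w z) \<in> borel_measurable A"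
proof -
  have S: "(\<lambda>z. (lam *\<^sub>R mat 1 + batch_S \<psi> n (T z) (b z)) $ i $ j) \<in> borel_measurable A" for i j
    using batch_S_comp[OF T b] by simp
  have "(\<lambda>z. (if j = k then w z $ i else (lam *\<^sub>R mat 1 + batch_S \<psi> n (T z) (b z)) $ i $ j)) \<in> borel_measurable A" for i j k
    using S[of i j] w by (cases "j = k") (simp_all add: borel_measurable_vec_nth)
  then show ?thesis
    unfolding matrix_inv_mult_vec_cramer[OF regularized_system_invertible[OF assms(4,5)]] borel_measurable_vec_iff
    by (auto simp only: vec_lambda_beta intro!: borel_measurable_divide det_measurable S)
qed

text \<open>The algebra with index \<open>k\<close> is generated by the batches before
  \<open>k\<close>. With the shifted index, \<open>\<Delta> k\<close> is computed from batch
  \<open>k - 1\<close>, so both sequences depend on the past only.\<close>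

lemma iterates_measurable:
  assumes X: "\<And>k i. i < n \<Longrightarrow> X k i \<in> measurable P M" and "lam > 0" "n \<ge> 1"
    and iter: "\<And>\<omega>. \<omega> \<in> space P \<Longrightarrow> spring_iterates H \<psi> lam mu eta \<theta>init \<Delta>init n
      (\<lambda>k i. X k i \<omega>) (\<lambda>k. \<theta> k \<omega>) (\<lambda>k. \<Delta> k \<omega>)"
  shows "\<theta> k \<in> borel_measurable (past_batches P M n X k) \<and> \<Delta> k \<in> borel_measurable (past_batches P M n X k)"
proof (induction k)
  case 0
  have init: "\<theta> 0 \<omega> = \<theta>init" "\<Delta> 0 \<omega> = \<Delta>init" if "\<omega> \<in> space P" for \<omega>
    using iter[OF that] by (simp_all add: spring_iterates_def)
  have "\<theta> 0 \<in> borel_measurable (past_batches P M n X 0)"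
    by (rule measurable_eq_on_space[where g = "\<lambda>_. \<theta>init"]) (auto simp: init)
  moreover have "\<Delta> 0 \<in> borel_measurable (past_batches P M n X 0)"
    by (rule measurable_eq_on_space[where g = "\<lambda>_. \<Delta>init"]) (auto simp: init)
  ultimately show ?case ..
next
  case (Suc k)
  let ?F = "past_batches P M n X (Suc k)"
  have sub: "subalgebra ?F (past_batches P M n X k)" by (rule past_batches_mono) simp
  have \<theta>[measurable]: "\<theta> k \<in> borel_measurable ?F" and \<Delta>[measurable]: "\<Delta> k \<in> borel_measurable ?F"
    using Suc measurable_from_subalg[OF sub] by auto
  have X': "(\<lambda>\<omega>. X k i \<omega>) \<in> measurable ?F M" if "i < n" for i
    by (rule past_batches_measurable) (use X that in auto)
  have g[measurable]: "(\<lambda>\<omega>. batch_grad H \<psi> n (\<theta> k \<omega>) (\<lambda>i. X k i \<omega>)) \<in> borel_measurable ?F"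
    by (rule batch_grad_comp[OF \<theta> X'])
  have "(\<lambda>\<omega>. matrix_inv (lam *\<^sub>R mat 1 + batch_S \<psi> n (\<theta> k \<omega>) (\<lambda>i. X k i \<omega>)) *v
      ((lam * mu) *\<^sub>R \<Delta> k \<omega> - (1 / 2) *\<^sub>R batch_grad H \<psi> n (\<theta> k \<omega>) (\<lambda>i. X k i \<omega>))) \<in> borel_measurable ?F"
    by (rule increment_comp[OF \<theta> _ X' assms(2,3)]) measurable
  moreover have "\<Delta> (Suc k) \<omega> = matrix_inv (lam *\<^sub>R mat 1 + batch_S \<psi> n (\<theta> k \<omega>) (\<lambda>i. X k i \<omega>)) *v
      ((lam * mu) *\<^sub>R \<Delta> k \<omega> - (1 / 2) *\<^sub>R batch_grad H \<psi> n (\<theta> k \<omega>) (\<lambda>i. X k i \<omega>))" if "\<omega> \<in> space P" for \<omega>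
    using iter[OF that] by (simp add: spring_iterates_def)
  ultimately have D[measurable]: "\<Delta> (Suc k) \<in> borel_measurable ?F"
    by (intro measurable_eq_on_space[where f = "\<Delta> (Suc k)"]) auto
  have "\<theta> (Suc k) \<omega> = \<theta> k \<omega> + eta k *\<^sub>R \<Delta> (Suc k) \<omega>" if "\<omega> \<in> space P" for \<omega>
    using iter[OF that] by (simp add: spring_iterates_def)
  moreover have "(\<lambda>\<omega>. \<theta> k \<omega> + eta k *\<^sub>R \<Delta> (Suc k) \<omega>) \<in> borel_measurable ?F" by measurable
  ultimately have "\<theta> (Suc k) \<in> borel_measurable ?F"
    by (intro measurable_eq_on_space[where f = "\<theta> (Suc k)"]) auto
  with D show ?case by simp
qed

section \<open>The law of a batch as a kernel in the parameter\<close>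

lemma emeasure_batch_law:
  assumes "\<And>i. i < n \<Longrightarrow> A i \<in> sets M"
  shows "emeasure (batch_law n \<theta>) (Pi\<^sub>E {..<n} A) = (\<Prod>i<n. emeasure (born M \<psi> \<theta>) (A i))"
proof -
  interpret product_sigma_finite "\<lambda>_::nat. born M \<psi> \<theta>"
    unfolding product_sigma_finite_def using prob_space_imp_sigma_finite[OF prob_space_born] by blast
  show ?thesis by (rule emeasure_PiM) (use assms in auto)
qed

lemma measure_batch_law:
  assumes "\<And>i. i < n \<Longrightarrow> A i \<in> sets M"
  shows "measure (batch_law n \<theta>) (Pi\<^sub>E {..<n} A) = (\<Prod>i<n. measure (born M \<psi> \<theta>) (A i))"
proof -
  interpret prob_space "born M \<psi> \<theta>" by (rule prob_space_born)
  have "emeasure (batch_law n \<theta>) (Pi\<^sub>E {..<n} A) = (\<Prod>i<n. emeasure (born M \<psi> \<theta>) (A i))"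
    by (rule emeasure_batch_law) (rule assms)
  also have "\<dots> = ennreal (\<Prod>i<n. measure (born M \<psi> \<theta>) (A i))"
    unfolding emeasure_eq_measure by (rule prod_ennreal) simp
  finally show ?thesis
    unfolding measure_def[of "batch_law n \<theta>"] by (simp only: enn2real_ennreal prod_nonneg measure_nonneg)
qed

lemma batch_law_measurable:
  "batch_law n \<in> measurable borel (prob_algebra (PiM {..<n} (\<lambda>_. M)))"
proof (rule measurable_prob_algebra_generated[OF sets_PiM_finite_rectangles Int_stable_rectangles])
  show "{Pi\<^sub>E {..<n} A |A. \<forall>i\<in>{..<n}. A i \<in> sets M} \<subseteq> Pow (space (PiM {..<n} (\<lambda>_. M)))"
    by (rule rectangles_into_space[where M = "\<lambda>_. M"])
  show "prob_space (batch_law n \<theta>)" for \<theta> by (intro prob_space_PiM prob_space_born)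
  show "sets (batch_law n \<theta>) = sets (PiM {..<n} (\<lambda>_. M))" for \<theta> by (intro sets_PiM_cong) auto
  fix A assume "A \<in> {Pi\<^sub>E {..<n} A |A. \<forall>i\<in>{..<n}. A i \<in> sets M}"
  then obtain B where B: "A = Pi\<^sub>E {..<n} B" "\<And>i. i < n \<Longrightarrow> B i \<in> sets M" by auto
  have "emeasure (batch_law n \<theta>) A = (\<Prod>i<n. emeasure (born M \<psi> \<theta>) (B i))" for \<theta>
    unfolding B(1) by (rule emeasure_batch_law) (rule B(2))
  then show "(\<lambda>\<theta>. emeasure (batch_law n \<theta>) A) \<in> borel_measurable borel"
    using B(2) by (auto intro!: borel_measurable_prod_ennreal emeasure_born_measurable)
qed simp

text \<open>An instance of \<open>nn_integral_freezing\<close> with rectangles as generator. The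
  batch is restricted to \<open>{..<n}\<close> because points of the product space are extensional
  functions.\<close>

lemma nn_integral_batch:
  assumes P: "prob_space P" and adaptive: "adaptive_batches P M \<psi> n X \<theta>"
    and \<theta>: "\<theta> k \<in> borel_measurable (past_batches P M n X k)"
    and f: "f \<in> borel_measurable (borel \<Otimes>\<^sub>M PiM {..<n} (\<lambda>_. M))"
  shows "(\<integral>\<^sup>+\<omega>. f (\<theta> k \<omega>, \<lambda>i\<in>{..<n}. X k i \<omega>) \<partial>P)
    = (\<integral>\<^sup>+\<omega>. (\<integral>\<^sup>+b. f (\<theta> k \<omega>, b) \<partial>batch_law n (\<theta> k \<omega>)) \<partial>P)"
proof -
  interpret prob_space P by (rule P)
  have X: "X k i \<in> measurable P M" if "i < n" for k i
    using adaptive that by (simp add: adaptive_batches_def)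
  have sub: "subalgebra P (past_batches P M n X k)" by (rule subalgebra_past_batches) (rule X)
  show ?thesis
  proof (rule nn_integral_freezing[where G = "{Pi\<^sub>E {..<n} A |A. \<forall>i\<in>{..<n}. A i \<in> sets M}" and S = "PiM {..<n} (\<lambda>_. M)"
        and N = borel and T = "\<theta> k" and Y = "\<lambda>\<omega>. \<lambda>i\<in>{..<n}. X k i \<omega>" and K = "batch_law n" and f = f])
    show "sets (PiM {..<n} (\<lambda>_. M)) =
        sigma_sets (space (PiM {..<n} (\<lambda>_. M))) {Pi\<^sub>E {..<n} A |A. \<forall>i\<in>{..<n}. A i \<in> sets M}"
      by (rule sets_PiM_finite_rectangles[where M = "\<lambda>_. M"]) simp
    show "Int_stable {Pi\<^sub>E {..<n} A |A. \<forall>i\<in>{..<n}. A i \<in> sets M}"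
      by (rule Int_stable_rectangles[where M = "\<lambda>_. M"])
    show "(\<lambda>\<omega>. \<lambda>i\<in>{..<n}. X k i \<omega>) \<in> measurable P (PiM {..<n} (\<lambda>_. M))"
      using X by (intro measurable_restrict) auto
    show "{Pi\<^sub>E {..<n} A |A. \<forall>i\<in>{..<n}. A i \<in> sets M} \<subseteq> Pow (space (PiM {..<n} (\<lambda>_. M)))"
      by (rule rectangles_into_space[where M = "\<lambda>_. M"])
    show "space (PiM {..<n} (\<lambda>_. M)) \<in> {Pi\<^sub>E {..<n} A |A. \<forall>i\<in>{..<n}. A i \<in> sets M}"
      by (rule space_PiM_rectangle[where M = "\<lambda>_. M"])
    show "subalgebra P (past_batches P M n X k)" by (rule sub)
    show "\<theta> k \<in> borel_measurable (past_batches P M n X k)" by (rule \<theta>)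
    show "batch_law n \<in> measurable borel (prob_algebra (PiM {..<n} (\<lambda>_. M)))" by (rule batch_law_measurable)
    show "f \<in> borel_measurable (borel \<Otimes>\<^sub>M PiM {..<n} (\<lambda>_. M))" by (rule f)
    fix B assume "B \<in> {Pi\<^sub>E {..<n} A |A. \<forall>i\<in>{..<n}. A i \<in> sets M}"
    then obtain A where B: "B = Pi\<^sub>E {..<n} A" "\<forall>i\<in>{..<n}. A i \<in> sets M" by blast
    from B(2) have A: "A i \<in> sets M" if "i < n" for i using that by blast
    have event: "(\<lambda>\<omega>. \<lambda>i\<in>{..<n}. X k i \<omega>) -` B \<inter> space P = {\<omega> \<in> space P. \<forall>i<n. X k i \<omega> \<in> A i}"
      proof -
      have "(\<lambda>i\<in>{..<n}. X k i \<omega>) \<in> B \<longleftrightarrow> (\<forall>i<n. X k i \<omega> \<in> A i)" for \<omega>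
        unfolding B(1) restrict_PiE_iff Ball_def lessThan_iff ..
      then show ?thesis by blast
    qed
    have prob: "measure (batch_law n (\<theta> k \<omega>)) B = (\<Prod>i<n. measure (born M \<psi> (\<theta> k \<omega>)) (A i))" for \<omega>
      unfolding B(1) by (rule measure_batch_law) (rule A)
    show "AE \<omega> in P. real_cond_exp P (past_batches P M n X k)
        (indicator ((\<lambda>\<omega>. \<lambda>i\<in>{..<n}. X k i \<omega>) -` B \<inter> space P)) \<omega> = measure (batch_law n (\<theta> k \<omega>)) B"
      unfolding event prob using adaptive A unfolding adaptive_batches_def by blast
  qed
qed


section \<open>Convergence of the iteration\<close>

text \<open>The estimator reads only the first \<open>n\<close> entries, so the restriction imposed
  by the product space is harmless.\<close>

lemma batch_grad_restrict: "batch_grad H \<psi> n \<theta> (\<lambda>i\<in>{..<n}. b i) = batch_grad H \<psi> n \<theta> b"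
  by (simp add: batch_grad_def batch_centered_energy_def batch_energy_def batch_centered_score_def cong: sum.cong_simp)

lemma batch_S_restrict: "batch_S \<psi> n \<theta> (\<lambda>i\<in>{..<n}. b i) = batch_S \<psi> n \<theta> b"
  by (simp add: batch_S_def batch_centered_score_def cong: sum.cong_simp)

lemma C\<^sub>m_nonneg: "0 \<le> C\<^sub>m"
  by (rule order_trans[OF Bochner_Integration.integral_nonneg score_moment(2)]) simp

lemma gradient_error_bound_nonneg: "0 \<le> gradient_error_bound"
  using C\<^sub>m_nonneg by (simp add: gradient_error_bound_def covariance_error_bound_def centered_moment_bound_def)

lemma energy_grad_measurable:
  assumes lipschitz: "\<And>x y. norm (energy_grad M H \<psi> x - energy_grad M H \<psi> y) \<le> C * norm (x - y)"
  shows "energy_grad M H \<psi> \<in> borel_measurable borel"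
proof (rule borel_measurable_continuous_onI)
  \<comment> \<open>Comparing the origin with a unit vector gives the sign of \<open>C\<close> that
    \<open>lipschitz_on\<close> demands.\<close>
  have "0 \<le> C"
    using order_trans[OF norm_ge_zero lipschitz[of "axis undefined 1" 0]] by simp
  then have "C-lipschitz_on UNIV (energy_grad M H \<psi>)"
    using lipschitz by (auto simp: lipschitz_on_def dist_norm)
  then show "continuous_on UNIV (energy_grad M H \<psi>)" by (rule lipschitz_on_continuous_on)
qed

text \<open>For a frozen parameter the error is bounded by \<open>batch_grad_error\<close>,
  uniformly in the parameter, so averaging over the iterate keeps the bound.\<close>

lemma expected_gradient_error:
  assumes P: "prob_space P" and adaptive: "adaptive_batches P M \<psi> n X \<theta>" and n: "n \<ge> 2"
    and \<theta>: "\<theta> k \<in> borel_measurable (past_batches P M n X k)" "\<theta> k \<in> borel_measurable P"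
    and [measurable]: "energy_grad M H \<psi> \<in> borel_measurable borel"
  shows "integrable P (\<lambda>\<omega>. (norm (batch_grad H \<psi> n (\<theta> k \<omega>) (\<lambda>i. X k i \<omega>) - energy_grad M H \<psi> (\<theta> k \<omega>)))\<^sup>2)"
    and "(\<integral>\<omega>. (norm (batch_grad H \<psi> n (\<theta> k \<omega>) (\<lambda>i. X k i \<omega>) - energy_grad M H \<psi> (\<theta> k \<omega>)))\<^sup>2 \<partial>P)
      \<le> gradient_error_bound / n"
proof -
  interpret prob_space P by (rule P)
  note [measurable] = \<theta>(2)
  have X: "X k i \<in> measurable P M" if "i < n" for k i
    using adaptive that by (simp add: adaptive_batches_def)
  have bound_nonneg: "0 \<le> gradient_error_bound / n" using gradient_error_bound_nonneg by simp
  define f where "f p = ennreal ((norm (batch_grad H \<psi> n (fst p) (snd p) - energy_grad M H \<psi> (fst p)))\<^sup>2)"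
    for p :: "(real ^ 'p) \<times> (nat \<Rightarrow> 'c)"
  have [measurable]: "(\<lambda>p. batch_grad H \<psi> n (fst p) (snd p)) \<in> borel_measurable (borel \<Otimes>\<^sub>M PiM {..<n} (\<lambda>_. M))"
    by (rule batch_grad_comp) auto
  have f: "f \<in> borel_measurable (borel \<Otimes>\<^sub>M PiM {..<n} (\<lambda>_. M))" unfolding f_def by measurable
  have "(\<integral>\<^sup>+b. f (\<theta>', b) \<partial>batch_law n \<theta>') \<le> ennreal (gradient_error_bound / n)" for \<theta>'
    unfolding f_def fst_conv snd_conv
    by (subst nn_integral_eq_integral[OF batch_grad_error(1)[OF n]]) (auto intro!: ennreal_leI batch_grad_error(2) n)
  then have "(\<integral>\<^sup>+\<omega>. f (\<theta> k \<omega>, \<lambda>i\<in>{..<n}. X k i \<omega>) \<partial>P) \<le> (\<integral>\<^sup>+\<omega>. ennreal (gradient_error_bound / n) \<partial>P)"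
    unfolding nn_integral_batch[where k = k, OF P adaptive \<theta>(1) f] by (intro nn_integral_mono)
  then have nn: "(\<integral>\<^sup>+\<omega>. ennreal ((norm (batch_grad H \<psi> n (\<theta> k \<omega>) (\<lambda>i. X k i \<omega>) - energy_grad M H \<psi> (\<theta> k \<omega>)))\<^sup>2) \<partial>P)
      \<le> ennreal (gradient_error_bound / n)"
    by (simp add: f_def batch_grad_restrict emeasure_space_1)
  have [measurable]: "(\<lambda>\<omega>. batch_grad H \<psi> n (\<theta> k \<omega>) (\<lambda>i. X k i \<omega>)) \<in> borel_measurable P"
    using X by (intro batch_grad_comp \<theta>(2)) auto
  show "integrable P (\<lambda>\<omega>. (norm (batch_grad H \<psi> n (\<theta> k \<omega>) (\<lambda>i. X k i \<omega>) - energy_grad M H \<psi> (\<theta> k \<omega>)))\<^sup>2)"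
    and "(\<integral>\<omega>. (norm (batch_grad H \<psi> n (\<theta> k \<omega>) (\<lambda>i. X k i \<omega>) - energy_grad M H \<psi> (\<theta> k \<omega>)))\<^sup>2 \<partial>P)
      \<le> gradient_error_bound / n"
    by (rule nonneg_integral_le_of_nn_integral[OF _ _ nn bound_nonneg]; simp)+
qed

lemma energy_grad_square_integrable:
  assumes P: "prob_space P" and [measurable]: "T \<in> borel_measurable P" "energy_grad M H \<psi> \<in> borel_measurable borel"
  shows "integrable P (\<lambda>\<omega>. (norm (energy_grad M H \<psi> (T \<omega>)))\<^sup>2)"
proof -
  interpret prob_space P by (rule P)
  show ?thesis
    by (rule integrable_const_bound[where B = "CARD('p) * (2 * (1 + centered_moment_bound C\<^sub>m))\<^sup>2"])
      (use energy_grad_bounded in auto)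
qed

lemma inner_batch_S_comp:
  assumes T: "T \<in> borel_measurable A" and v: "v \<in> borel_measurable A"
    and b: "\<And>i. i < n \<Longrightarrow> (\<lambda>z. b z i) \<in> measurable A M"
  shows "(\<lambda>z. inner (v z) (batch_S \<psi> n (T z) (b z) *v v z)) \<in> borel_measurable A"
  unfolding inner_batch_S using assms
  by (intro borel_measurable_divide borel_measurable_sum borel_measurable_times borel_measurable_inner
      borel_measurable_const batch_centered_score_comp) auto

text \<open>Given the past, the gradient at \<open>\<theta> k\<close> is a fixed vector while the
  matrix comes from the fresh batch, so only the conditional mean of its quadratic form
  matters.\<close>

lemma expected_inner_batch_S:
  assumes P: "prob_space P" and adaptive: "adaptive_batches P M \<psi> n X \<theta>" and n: "n \<ge> 2"
    and \<theta>: "\<theta> k \<in> borel_measurable (past_batches P M n X k)" "\<theta> k \<in> borel_measurable P"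
    and g[measurable]: "energy_grad M H \<psi> \<in> borel_measurable borel"
  defines "r \<equiv> \<lambda>\<omega>. inner (energy_grad M H \<psi> (\<theta> k \<omega>))
      (batch_S \<psi> n (\<theta> k \<omega>) (\<lambda>i. X k i \<omega>) *v energy_grad M H \<psi> (\<theta> k \<omega>))"
  shows "integrable P r"
    and "(\<integral>\<omega>. r \<omega> \<partial>P) \<le> 2 * (1 + C\<^sub>m) * (\<integral>\<omega>. (norm (energy_grad M H \<psi> (\<theta> k \<omega>)))\<^sup>2 \<partial>P)"
proof -
  interpret prob_space P by (rule P)
  note [measurable] = \<theta>(2)
  have X: "X k i \<in> measurable P M" if "i < n" for k i
    using adaptive that by (simp add: adaptive_batches_def)
  define f where "f p = ennreal (inner (energy_grad M H \<psi> (fst p)) (batch_S \<psi> n (fst p) (snd p) *v energy_grad M H \<psi> (fst p)))"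
    for p :: "(real ^ 'p) \<times> (nat \<Rightarrow> 'c)"
  have [measurable]: "(\<lambda>p. inner (energy_grad M H \<psi> (fst p)) (batch_S \<psi> n (fst p) (snd p) *v energy_grad M H \<psi> (fst p)))
      \<in> borel_measurable (borel \<Otimes>\<^sub>M PiM {..<n} (\<lambda>_. M))"
    by (rule inner_batch_S_comp) auto
  have f: "f \<in> borel_measurable (borel \<Otimes>\<^sub>M PiM {..<n} (\<lambda>_. M))" unfolding f_def by measurable
  have int: "integrable P (\<lambda>\<omega>. 2 * (1 + C\<^sub>m) * (norm (energy_grad M H \<psi> (\<theta> k \<omega>)))\<^sup>2)"
    by (intro integrable_mult_right energy_grad_square_integrable P g \<theta>(2))
  have "(\<integral>\<^sup>+\<omega>. f (\<theta> k \<omega>, \<lambda>i\<in>{..<n}. X k i \<omega>) \<partial>P)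
      \<le> (\<integral>\<^sup>+\<omega>. ennreal (2 * (1 + C\<^sub>m) * (norm (energy_grad M H \<psi> (\<theta> k \<omega>)))\<^sup>2) \<partial>P)"
    unfolding nn_integral_batch[where k = k, OF P adaptive \<theta>(1) f] unfolding f_def fst_conv snd_conv
    by (intro nn_integral_mono nn_integral_inner_batch_S n)
  also have "\<dots> = ennreal (\<integral>\<omega>. 2 * (1 + C\<^sub>m) * (norm (energy_grad M H \<psi> (\<theta> k \<omega>)))\<^sup>2 \<partial>P)"
    by (rule nn_integral_eq_integral[OF int]) (use C\<^sub>m_nonneg in simp)
  finally have nn: "(\<integral>\<^sup>+\<omega>. ennreal (r \<omega>) \<partial>P) \<le> ennreal (2 * (1 + C\<^sub>m) * (\<integral>\<omega>. (norm (energy_grad M H \<psi> (\<theta> k \<omega>)))\<^sup>2 \<partial>P))"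
    unfolding f_def r_def fst_conv snd_conv batch_S_restrict by simp
  have r: "r \<in> borel_measurable P" unfolding r_def
    by (rule inner_batch_S_comp) (auto intro: X)
  have r0: "0 \<le> r \<omega>" for \<omega> unfolding r_def using n by (intro inner_batch_S_nonneg) simp
  have nonneg: "0 \<le> 2 * (1 + C\<^sub>m) * (\<integral>\<omega>. (norm (energy_grad M H \<psi> (\<theta> k \<omega>)))\<^sup>2 \<partial>P)"
    using C\<^sub>m_nonneg by (intro mult_nonneg_nonneg Bochner_Integration.integral_nonneg) auto
  show "integrable P r" "(\<integral>\<omega>. r \<omega> \<partial>P) \<le> 2 * (1 + C\<^sub>m) * (\<integral>\<omega>. (norm (energy_grad M H \<psi> (\<theta> k \<omega>)))\<^sup>2 \<partial>P)"
    by (rule nonneg_integral_le_of_nn_integral[OF r r0 nn nonneg])+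
qed

text \<open>The pathwise inequality is integrated term by term;
  \<open>expected_gradient_error\<close> and \<open>expected_inner_batch_S\<close> bound the two
  random sums.\<close>

lemma weighted_gradient_bound:
  fixes lam mu C :: real and eta :: "nat \<Rightarrow> real" and \<theta>init \<Delta>init :: "real ^ 'p" and P :: "'o measure"
  assumes differentiable: "\<And>\<theta>. energy M H \<psi> differentiable (at \<theta>)"
    and lipschitz: "\<And>x y. norm (energy_grad M H \<psi> x - energy_grad M H \<psi> y) \<le> C * norm (x - y)"
    and lam: "lam > 0" and mu: "0 \<le> mu" "mu < 1" and C: "C > 0"
    and eta_pos: "\<And>k. 0 < eta k" and eta_Suc: "\<And>k. eta (Suc k) \<le> eta k"
    and eta_0: "eta 0 \<le> 2 * lam * (1 - mu) / C"
    and n: "n \<ge> 2" and P: "prob_space P" and adaptive: "adaptive_batches P M \<psi> n X \<theta>"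
    and iter: "\<And>\<omega>. \<omega> \<in> space P \<Longrightarrow> spring_iterates H \<psi> lam mu eta \<theta>init \<Delta>init n
      (\<lambda>k i. X k i \<omega>) (\<lambda>k. \<theta> k \<omega>) (\<lambda>k. \<Delta> k \<omega>)"
    and c: "c = 64 * lam\<^sup>2 / (lam * (1 - mu)) + 8 * (1 + C\<^sub>m)"
    and d: "d = (1 / 2 + c / (2 * (lam * (1 - mu)))) * gradient_error_bound"
  shows "(\<Sum>k=1..K. eta k * (\<integral>\<omega>. (norm (energy_grad M H \<psi> (\<theta> k \<omega>)))\<^sup>2 \<partial>P))
    \<le> 4 * (c * (2 * (1 + C\<^sub>m) + lam * mu * eta 0 * (norm \<Delta>init)\<^sup>2) + d * eta 0)
      + 4 * d * (1 / n) * (\<Sum>k=1..K. eta k)"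
proof -
  interpret prob_space P by (rule P)
  define g where "g k \<omega> = energy_grad M H \<psi> (\<theta> k \<omega>)" for k \<omega>
  define v where "v k \<omega> = batch_grad H \<psi> n (\<theta> k \<omega>) (\<lambda>i. X k i \<omega>)" for k \<omega>
  define S where "S k \<omega> = batch_S \<psi> n (\<theta> k \<omega>) (\<lambda>i. X k i \<omega>)" for k \<omega>
  define r where "r k \<omega> = inner (g k \<omega>) (S k \<omega> *v g k \<omega>)" for k \<omega>
  define A where "A = c * (2 * (1 + C\<^sub>m) + lam * mu * eta 0 * (norm \<Delta>init)\<^sup>2)"
  define w where "w = 1 / 2 + c / (2 * (lam * (1 - mu)))"
  \<comment> \<open>Chosen so that \<open>t * (2 * (1 + C\<^sub>m)) = 1 / 8\<close>: the expected
    quadratic forms then cost only 1/8 of the weighted gradient sum. It also turns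
    \<open>1 / (2 * t)\<close> into the second summand of \<open>c\<close>.\<close>
  define t where "t = 1 / (16 * (1 + C\<^sub>m))"
  have t: "t > 0" using C\<^sub>m_nonneg by (simp add: t_def)
  have c': "c = 64 * lam\<^sup>2 / (lam * (1 - mu)) + 1 / (2 * t)"
    using C\<^sub>m_nonneg unfolding c t_def by simp
  have w0: "0 \<le> w" unfolding w_def c using lam mu C\<^sub>m_nonneg by simp
  have path: "3 / 8 * (\<Sum>k=1..K. eta k * (norm (g k \<omega>))\<^sup>2)
      \<le> A + w * (\<Sum>k\<le>K. eta k * (norm (v k \<omega> - g k \<omega>))\<^sup>2) + t * (\<Sum>k=1..K. eta k * r k \<omega>)"
    if \<omega>: "\<omega> \<in> space P" for \<omega>
  proof -
    note it = iter[OF \<omega>, unfolded spring_iterates_def]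
    interpret momentum_path "energy M H \<psi>" "energy_grad M H \<psi>" lam mu C "1 + C\<^sub>m" eta
      "\<lambda>k. \<theta> k \<omega>" "\<lambda>k. \<Delta> k \<omega>" "\<lambda>k. S k \<omega> *v \<Delta> (Suc k) \<omega>" "\<lambda>k. v k \<omega>" "\<lambda>k. r k \<omega>"
    proof
      show "GDERIV (energy M H \<psi>) x :> energy_grad M H \<psi> x" for x
        unfolding energy_grad_def by (rule GDERIV_grad[OF differentiable])
      show "lam *\<^sub>R \<Delta> (Suc k) \<omega> + S k \<omega> *v \<Delta> (Suc k) \<omega> = (lam * mu) *\<^sub>R \<Delta> k \<omega> - (1 / 2) *\<^sub>R v k \<omega>" for k
      proof -
        let ?w = "(lam * mu) *\<^sub>R \<Delta> k \<omega> - (1 / 2) *\<^sub>R v k \<omega>"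
        have inv: "invertible (lam *\<^sub>R mat 1 + S k \<omega>)"
          unfolding S_def using lam n by (intro regularized_system_invertible) auto
        have "\<Delta> (Suc k) \<omega> = matrix_inv (lam *\<^sub>R mat 1 + S k \<omega>) *v ?w"
          using it by (simp add: S_def v_def)
        then have "(lam *\<^sub>R mat 1 + S k \<omega>) *v \<Delta> (Suc k) \<omega> = ?w"
          by (simp only: matrix_inv_mult_vec[OF inv])
        then show ?thesis
          by (simp add: matrix_vector_mult_add_rdistrib scaleR_matrix_vector_assoc[symmetric])
      qed
      show "0 \<le> inner (S k \<omega> *v \<Delta> (Suc k) \<omega>) (\<Delta> (Suc k) \<omega>)" for k
        unfolding S_def inner_commute[of "_ *v _"] using n by (intro inner_batch_S_nonneg) simp
      show "- 2 * inner (energy_grad M H \<psi> (\<theta> k \<omega>)) (S k \<omega> *v \<Delta> (Suc k) \<omega>)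
          \<le> s * r k \<omega> + inner (S k \<omega> *v \<Delta> (Suc k) \<omega>) (\<Delta> (Suc k) \<omega>) / s" if "s > 0" for k s
        unfolding r_def S_def g_def inner_commute[of "_ *v _"] using n that by (intro inner_batch_S_weighted) auto
      show "\<theta> (Suc k) \<omega> = \<theta> k \<omega> + eta k *\<^sub>R \<Delta> (Suc k) \<omega>" for k using it by simp
    qed (fact lipschitz energy_bounded lam mu C eta_pos eta_Suc eta_0)+
    have "\<Delta> 0 \<omega> = \<Delta>init" using it by simp
    then show ?thesis using weighted_gradient_sum_le[OF t c', of K] by (simp add: A_def w_def g_def)
  qed
  have X: "X k i \<in> measurable P M" if "i < n" for k i
    using adaptive that by (simp add: adaptive_batches_def)
  have \<theta>F: "\<theta> k \<in> borel_measurable (past_batches P M n X k)" for k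
    using iterates_measurable[OF X lam _ iter, of k] n by simp
  have \<theta>P: "\<theta> k \<in> borel_measurable P" for k
    by (rule measurable_from_subalg[OF subalgebra_past_batches \<theta>F]) (rule X)
  note meas = energy_grad_measurable[OF lipschitz]
  have g: "integrable P (\<lambda>\<omega>. (norm (g k \<omega>))\<^sup>2)" for k
    unfolding g_def by (rule energy_grad_square_integrable[OF P \<theta>P meas])
  have e: "integrable P (\<lambda>\<omega>. (norm (v k \<omega> - g k \<omega>))\<^sup>2)"
    "(\<integral>\<omega>. (norm (v k \<omega> - g k \<omega>))\<^sup>2 \<partial>P) \<le> gradient_error_bound / n" for k
    unfolding v_def g_def by (rule expected_gradient_error[where k = k, OF P adaptive n \<theta>F \<theta>P meas])+
  have r: "integrable P (r k)" "(\<integral>\<omega>. r k \<omega> \<partial>P) \<le> 2 * (1 + C\<^sub>m) * (\<integral>\<omega>. (norm (g k \<omega>))\<^sup>2 \<partial>P)" for k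
    unfolding r_def[abs_def] S_def g_def
    by (rule expected_inner_batch_S[where k = k, OF P adaptive n \<theta>F \<theta>P meas])+
  define G where "G = (\<Sum>k=1..K. eta k * (\<integral>\<omega>. (norm (g k \<omega>))\<^sup>2 \<partial>P))"
  have "3 / 8 * G = (\<integral>\<omega>. 3 / 8 * (\<Sum>k=1..K. eta k * (norm (g k \<omega>))\<^sup>2) \<partial>P)"
    unfolding G_def using g by (simp add: Bochner_Integration.integral_sum)
  also have "\<dots> \<le> (\<integral>\<omega>. A + w * (\<Sum>k\<le>K. eta k * (norm (v k \<omega> - g k \<omega>))\<^sup>2) + t * (\<Sum>k=1..K. eta k * r k \<omega>) \<partial>P)"
    using g e(1) r(1) path by (intro integral_mono) auto
  also have "\<dots> = A + w * (\<Sum>k\<le>K. eta k * (\<integral>\<omega>. (norm (v k \<omega> - g k \<omega>))\<^sup>2 \<partial>P)) + t * (\<Sum>k=1..K. eta k * (\<integral>\<omega>. r k \<omega> \<partial>P))"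
    using e(1) r(1) by (simp add: Bochner_Integration.integral_sum prob_space)
  also have "\<dots> \<le> A + w * (\<Sum>k\<le>K. eta k * (gradient_error_bound / n))
      + t * (\<Sum>k=1..K. eta k * (2 * (1 + C\<^sub>m) * (\<integral>\<omega>. (norm (g k \<omega>))\<^sup>2 \<partial>P)))"
    using w0 t eta_pos e(2) r(2) by (intro add_mono mult_left_mono sum_mono order_refl) (auto intro: less_imp_le)
  also have "t * (\<Sum>k=1..K. eta k * (2 * (1 + C\<^sub>m) * (\<integral>\<omega>. (norm (g k \<omega>))\<^sup>2 \<partial>P))) = t * (2 * (1 + C\<^sub>m)) * G"
    by (simp add: G_def sum_distrib_left mult_ac)
  also have "t * (2 * (1 + C\<^sub>m)) = 1 / 8" using C\<^sub>m_nonneg by (simp add: t_def)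
  also have "w * (\<Sum>k\<le>K. eta k * (gradient_error_bound / n)) = d * (1 / n) * (\<Sum>k\<le>K. eta k)"
    unfolding sum_distrib_right[symmetric] d w_def[symmetric] by simp
  \<comment> \<open>The gradient errors are summed from step 0; the extra term \<open>eta 0\<close>
    is moved into the constant, using \<open>1 / n \<le> 1\<close>.\<close>
  also have "(\<Sum>k\<le>K. eta k) = eta 0 + (\<Sum>k=1..K. eta k)"
    using sum.atMost_shift[of eta K] sum.atLeast1_atMost_eq[of eta K] by simp
  also have "d * (1 / n) * (eta 0 + (\<Sum>k=1..K. eta k)) \<le> d * eta 0 + d * (1 / n) * (\<Sum>k=1..K. eta k)"
  proof -
    have "0 \<le> d" unfolding d using w0 gradient_error_bound_nonneg by (simp add: w_def)
    then have "d * (1 / n) * eta 0 \<le> d * 1 * eta 0"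
      using n eta_pos[of 0] by (intro mult_right_mono mult_left_mono) auto
    then show ?thesis by (simp only: distrib_left mult_1_right)
  qed
  \<comment> \<open>Moving 1/8 of the sum to the left leaves 1/4 of it, hence the factor 4 in the
    constants.\<close>
  finally have "3 / 8 * G \<le> A + (d * eta 0 + d * (1 / n) * (\<Sum>k=1..K. eta k)) + 1 / 8 * G" by simp
  moreover have "x \<le> 4 * y" if "3 / 8 * x \<le> y + 1 / 8 * x" for x y :: real using that by linarith
  ultimately have "G \<le> 4 * (A + (d * eta 0 + d * (1 / n) * (\<Sum>k=1..K. eta k)))" by blast
  then show ?thesis by (simp only: G_def g_def A_def mult.assoc distrib_left add.assoc)
qed

end

section \<open>The bound for the configuration space of N particles\<close>

theorem theorem3p2:
  fixes \<Omega> :: "'w measure" and N :: nat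
    and D :: "((nat \<Rightarrow> 'w) \<Rightarrow> real) set"
    and H :: "((nat \<Rightarrow> 'w) \<Rightarrow> real) \<Rightarrow> (nat \<Rightarrow> 'w) \<Rightarrow> real"
    and \<psi> :: "real ^ 'p \<Rightarrow> (nat \<Rightarrow> 'w) \<Rightarrow> real"
    and lam mu C\<^sub>m C\<^sub>g :: real and eta :: "nat \<Rightarrow> real"
    and \<theta>init \<Delta>init :: "real ^ 'p"
  assumes \<Omega>: "sigma_finite_measure \<Omega>" and N: "N \<ge> 1"
    and H: "self_adjoint_operator (config_space \<Omega> N) D H"
    and \<psi>_dom: "\<And>\<theta>. \<psi> \<theta> \<in> D"
    and \<psi>_nonzero: "\<And>\<theta>. \<not> (AE x in config_space \<Omega> N. \<psi> \<theta> x = 0)"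
    and \<psi>_measurable:
      "(\<lambda>(\<theta>, x). \<psi> \<theta> x) \<in> borel_measurable (borel \<Otimes>\<^sub>M config_space \<Omega> N)"
    and H\<psi>_measurable:
      "(\<lambda>(\<theta>, x). H (\<psi> \<theta>) x) \<in> borel_measurable (borel \<Otimes>\<^sub>M config_space \<Omega> N)"
    and \<psi>_differentiable:
      "\<And>\<theta> x. x \<in> space (config_space \<Omega> N) \<Longrightarrow> \<psi> \<theta> x \<noteq> 0 \<Longrightarrow> (\<lambda>t. \<psi> t x) differentiable (at \<theta>)"
    and energy_differentiable:
      "\<And>\<theta>. energy (config_space \<Omega> N) H \<psi> differentiable (at \<theta>)"
    and vmc_identity:
      "\<And>\<theta>. energy_grad (config_space \<Omega> N) H \<psi> \<theta> =
         2 *\<^sub>R (\<integral>x. centered_energy (config_space \<Omega> N) H \<psi> \<theta> x *\<^sub>R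
                  centered_score (config_space \<Omega> N) \<psi> \<theta> x \<partial>born (config_space \<Omega> N) \<psi> \<theta>)"
    and lam: "lam > 0" and mu: "0 \<le> mu" "mu < 1"
    and C\<^sub>m: "C\<^sub>m > 0"
    and score_moment:
      "\<And>\<theta>. integrable (born (config_space \<Omega> N) \<psi> \<theta>) (\<lambda>x. norm (score \<psi> \<theta> x) ^ 4)"
      "\<And>\<theta>. (\<integral>x. norm (score \<psi> \<theta> x) ^ 4 \<partial>born (config_space \<Omega> N) \<psi> \<theta>) \<le> C\<^sub>m"
    and energy_moment:
      "\<And>\<theta>. integrable (born (config_space \<Omega> N) \<psi> \<theta>) (\<lambda>x. local_energy H \<psi> \<theta> x ^ 4)"
      "\<And>\<theta>. (\<integral>x. local_energy H \<psi> \<theta> x ^ 4 \<partial>born (config_space \<Omega> N) \<psi> \<theta>) \<le> C\<^sub>m"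
    and C\<^sub>g: "C\<^sub>g > 0"
    and grad_lipschitz:
      "\<And>\<theta> \<theta>'. norm (energy_grad (config_space \<Omega> N) H \<psi> \<theta> - energy_grad (config_space \<Omega> N) H \<psi> \<theta>')
                 \<le> C\<^sub>g * norm (\<theta> - \<theta>')"
    and eta_decreasing: "\<And>k. k \<ge> 1 \<Longrightarrow> 0 < eta k \<and> eta k \<le> eta (k - 1)"
    and eta_0: "0 < eta 0" "eta 0 \<le> 2 * lam * (1 - mu) / C\<^sub>g"
  shows "\<exists>C\<^sub>1>0. \<exists>C\<^sub>2>0. \<exists>C\<^sub>3>0.
    \<forall>N\<^sub>s\<ge>2. \<forall>(P :: 'o measure) X \<theta> \<Delta>.
      prob_space P \<longrightarrow>
      (\<forall>\<omega>\<in>space P. spring_iterates H \<psi> lam mu eta \<theta>init \<Delta>init N\<^sub>s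
                       (\<lambda>k i. X k i \<omega>) (\<lambda>k. \<theta> k \<omega>) (\<lambda>k. \<Delta> k \<omega>)) \<longrightarrow>
      adaptive_batches P (config_space \<Omega> N) \<psi> N\<^sub>s X \<theta> \<longrightarrow>
      (\<forall>K\<ge>1.
        (\<Sum>k=1..K. eta k * (\<integral>\<omega>. (norm (energy_grad (config_space \<Omega> N) H \<psi> (\<theta> k \<omega>)))\<^sup>2 \<partial>P))
          \<le> C\<^sub>1 + C\<^sub>2 * (1 / real N\<^sub>s) * (\<Sum>k=1..K. eta k)
               + C\<^sub>3 * (1 / (real N\<^sub>s)\<^sup>2) * (\<Sum>k=1..K. eta k))"
proof -
  let ?M = "config_space \<Omega> N"
  interpret vmc ?M H \<psi> C\<^sub>m
  proof (rule vmc.intro)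
    have "product_sigma_finite (\<lambda>_::nat. \<Omega>)" using \<Omega> by (simp add: product_sigma_finite_def)
    then show "sigma_finite_measure ?M" by (rule product_sigma_finite.sigma_finite) simp
    show "\<psi> \<theta> \<in> L2 ?M" for \<theta>
      using H \<psi>_dom[of \<theta>] unfolding self_adjoint_operator_def by blast
  qed (fact \<psi>_nonzero \<psi>_measurable H\<psi>_measurable \<psi>_differentiable vmc_identity score_moment energy_moment)+
  have eta_pos: "0 < eta k" for k using eta_0(1) eta_decreasing[of k] by (cases "k = 0") auto
  have eta_Suc: "eta (Suc k) \<le> eta k" for k using eta_decreasing[of "Suc k"] by simp
  \<comment> \<open>These constants are built from \<open>lam\<close>, \<open>mu\<close>,
    \<open>eta 0\<close>, \<open>C\<^sub>m\<close>, the norm of \<open>\<Delta>init\<close> and the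
    number of parameters alone, hence fixed before the sample size, the probability space and
    \<open>K\<close>.\<close>
  define c where "c = 64 * lam\<^sup>2 / (lam * (1 - mu)) + 8 * (1 + C\<^sub>m)"
  define d where "d = (1 / 2 + c / (2 * (lam * (1 - mu)))) * gradient_error_bound"
  define C\<^sub>1 where "C\<^sub>1 = 4 * (c * (2 * (1 + C\<^sub>m) + lam * mu * eta 0 * (norm \<Delta>init)\<^sup>2) + d * eta 0)"
  have "0 \<le> c" unfolding c_def using lam mu C\<^sub>m by simp
  then have d: "0 \<le> d" unfolding d_def using lam mu gradient_error_bound_nonneg by simp
  have C\<^sub>1: "0 \<le> C\<^sub>1"
    unfolding C\<^sub>1_def using \<open>0 \<le> c\<close> d lam mu C\<^sub>m eta_0(1) by (intro mult_nonneg_nonneg add_nonneg_nonneg) auto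
  show ?thesis
  \<comment> \<open>Adding 1 makes the first two constants strictly positive. The estimate holds
    with these two terms, so the nonnegative third term can be added with constant 1.\<close>
  proof (rule exI[of _ "C\<^sub>1 + 1"], rule conjI[rotated], rule exI[of _ "4 * d + 1"], rule conjI[rotated],
      rule exI[of _ 1], rule conjI[rotated], intro allI impI)
    fix N\<^sub>s :: nat and P :: "'o measure" and X \<theta> \<Delta> and K :: nat
    assume n: "2 \<le> N\<^sub>s" and P: "prob_space P"
      and iter: "\<forall>\<omega>\<in>space P. spring_iterates H \<psi> lam mu eta \<theta>init \<Delta>init N\<^sub>s
        (\<lambda>k i. X k i \<omega>) (\<lambda>k. \<theta> k \<omega>) (\<lambda>k. \<Delta> k \<omega>)"
      and adaptive: "adaptive_batches P ?M \<psi> N\<^sub>s X \<theta>"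
    let ?E = "\<Sum>k=1..K. eta k"
    have E: "0 \<le> ?E" by (intro sum_nonneg) (simp add: eta_pos less_imp_le)
    have "(\<Sum>k=1..K. eta k * (\<integral>\<omega>. (norm (energy_grad ?M H \<psi> (\<theta> k \<omega>)))\<^sup>2 \<partial>P))
        \<le> C\<^sub>1 + 4 * d * (1 / N\<^sub>s) * ?E"
      unfolding C\<^sub>1_def
      by (rule weighted_gradient_bound[OF energy_differentiable grad_lipschitz lam mu C\<^sub>g eta_pos eta_Suc eta_0(2)
            n P adaptive bspec[OF iter] c_def d_def])
    also have "\<dots> \<le> (C\<^sub>1 + 1) + (4 * d + 1) * (1 / N\<^sub>s) * ?E + 1 * (1 / (real N\<^sub>s)\<^sup>2) * ?E"
    proof -
      have "4 * d * (1 / N\<^sub>s) * ?E \<le> (4 * d + 1) * (1 / N\<^sub>s) * ?E" using E by (intro mult_right_mono) auto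
      moreover have "0 \<le> 1 * (1 / (real N\<^sub>s)\<^sup>2) * ?E" using E by simp
      ultimately show ?thesis by linarith
    qed
    finally show "(\<Sum>k=1..K. eta k * (\<integral>\<omega>. (norm (energy_grad ?M H \<psi> (\<theta> k \<omega>)))\<^sup>2 \<partial>P))
        \<le> (C\<^sub>1 + 1) + (4 * d + 1) * (1 / real N\<^sub>s) * ?E + 1 * (1 / (real N\<^sub>s)\<^sup>2) * ?E" .
  qed (use C\<^sub>1 d in auto)
qed

end
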